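(* Assume $(\mathbf A_\sigma)$, and let $(\mathcal T^n)_{n\ge0}$ be a sequence of strategies. For any $\rho>0$: (i) if the sequence satisfies $(\mathbf A_S)$, then $\sup_{n\ge0}\bigl(\varepsilon_n^{\rho-1}\sup_{1\le i\le N^n_T}\Delta\tau^n_i\bigr)<+\infty$ a.s.; (ii) if the sequence satisfies $(\mathbf A_S)$ and $(\mathbf A_N)$, then $\sup_{n\ge0}\bigl(\varepsilon_n^{\rho-2}\sup_{1\le i\le N^n_T}\Delta\tau^n_i\bigr)<+\infty$ a.s.
   Context: Model. $T>0$; $(\Omega,\mathcal F,(\mathcal F_t)_{0\le t\le T},\mathbb P)$ supports a $d$-dimensional Brownian motion $B$ on $[0,T]$, $(\mathcal F_t)$ is the $\mathbb P$-augmented natural filtration of $B$, $\mathcal F=\mathcal F_T$. $S$ is the $\mathbb R^d$-valued continuous local martingale $S_t=S_0+\int_0^t\sigma_s\,dB_s$, with $\sigma$ a measurable adapted $d\times d$-matrix-valued process. $|\cdot|$ is the Euclidean norm and the induced matrix norm. $(\mathbf A_\sigma)$: a.s., $\sigma_t\ne0$ for every $t\in[0,T]$; and there are $\theta_\sigma\in(0,1]$ and a nonnegative a.s. finite random variable $C_0$ such that a.s. $|\sigma_t-\sigma_s|\le C_0(|S_t-S_s|^{\theta_\sigma}+|t-s|^{\theta_\sigma/2})$ for all $0\le s,t\le T$. Strategies. $(\varepsilon_n)_{n\ge0}$ is a fixed sequence of positive deterministic reals with $\varepsilon_n\to0$ and $\sum_n\varepsilon_n^2<+\infty$. A sequence of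 strategies is $(\mathcal T^n)_{n\ge0}$, $\mathcal T^n=\{\tau^n_0=0<\tau^n_1<\cdots<\tau^n_{N^n_T}=T\}$, where the $\tau_i^n$ are stopping times and $N^n_T$ is a.s. finite (random). $\Delta\tau^n_i:=\tau^n_i-\tau^n_{i-1}$. $(\mathbf A_N)$: a.s. $\sup_{n\ge0}(\varepsilon_n^{2\rho_N}N^n_T)<+\infty$, for a parameter $\rho_N$ with $1\le\rho_N<(1+\theta_\sigma/2)\wedge\frac43$. $(\mathbf A_S)$: a.s. $\sup_{n\ge0}\bigl(\varepsilon_n^{-2}\sup_{1\le i\le N^n_T}\sup_{t\in(\tau^n_{i-1},\tau^n_i]}|S_t-S_{\tau^n_{i-1}}|^2\bigr)<+\infty$. *)

theory Defs
  imports "HOL-Probability.Probability"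
begin

section \<open>Brownian motion and its augmented filtration\<close>

text \<open>The index \<open>min t T\<close> makes the filtration constant after the horizon; for \<open>t < 0\<close> the natural
  filtration is trivial.\<close>

definition natural_filtration ::
  "'w measure \<Rightarrow> real \<Rightarrow> (real \<Rightarrow> 'w \<Rightarrow> real ^ 'd) \<Rightarrow> real \<Rightarrow> 'w measure" where
  "natural_filtration M T B t =
     sigma (space M) {B s -` A \<inter> space M | s A. s \<in> {0..min t T} \<and> A \<in> sets borel}"

definition negligible_sets ::
  "'w measure \<Rightarrow> real \<Rightarrow> (real \<Rightarrow> 'w \<Rightarrow> real ^ 'd) \<Rightarrow> 'w set set" where
  "negligible_sets M T B =
     {Z. \<exists>G \<in> sets (natural_filtration M T B T). Z \<subseteq> G \<and> emeasure M G = 0}"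

definition augmented_filtration ::
  "'w measure \<Rightarrow> real \<Rightarrow> (real \<Rightarrow> 'w \<Rightarrow> real ^ 'd) \<Rightarrow> real \<Rightarrow> 'w measure" where
  "augmented_filtration M T B t =
     sigma (space M) (sets (natural_filtration M T B t) \<union> negligible_sets M T B)"

text \<open>Increments over \<open>[s, t]\<close> have the law \<open>N(0, (t - s) I)\<close>, given by its product density.\<close>

definition brownian_motion ::
  "'w measure \<Rightarrow> real \<Rightarrow> (real \<Rightarrow> 'w \<Rightarrow> real ^ 'd) \<Rightarrow> bool" where
  "brownian_motion M T B \<longleftrightarrow>
     prob_space M \<and>
     (\<forall>t \<in> {0..T}. B t \<in> borel_measurable M) \<and>
     (AE \<omega> in M. B 0 \<omega> = 0) \<and>
     (AE \<omega> in M. continuous_on {0..T} (\<lambda>t. B t \<omega>)) \<and>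
     (\<forall>s t. 0 \<le> s \<and> s < t \<and> t \<le> T \<longrightarrow>
        prob_space.indep_set M (sets (natural_filtration M T B s))
          {(\<lambda>\<omega>. B t \<omega> - B s \<omega>) -` A \<inter> space M | A. A \<in> sets borel} \<and>
        distributed M lborel (\<lambda>\<omega>. B t \<omega> - B s \<omega>)
          (\<lambda>x. ennreal (\<Prod>j\<in>UNIV. normal_density 0 (sqrt (t - s)) (x $ j))))"

section \<open>Stochastic integrals\<close>

text \<open>A simple integrand with data \<open>m, p, \<xi>\<close> is the matrix process
  \<open>\<Sum>k<m. 1_(p k, p (k+1)](t) \<xi> k\<close>, with \<open>\<xi> k\<close> bounded and measurable at time \<open>p k\<close>.\<close>

definition simple_data ::
  "(real \<Rightarrow> 'w measure) \<Rightarrow> real \<Rightarrow> nat \<Rightarrow> (nat \<Rightarrow> real) \<Rightarrow> (nat \<Rightarrow> 'w \<Rightarrow> real ^ 'd ^ 'd) \<Rightarrow> bool" where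
  "simple_data F T m p \<xi> \<longleftrightarrow>
     p 0 = 0 \<and> p m = T \<and> (\<forall>k<m. p k \<le> p (Suc k)) \<and>
     (\<forall>k<m. \<xi> k \<in> borel_measurable (F (p k)) \<and> (\<exists>C. \<forall>\<omega>. norm (\<xi> k \<omega>) \<le> C))"

definition simple_process ::
  "nat \<Rightarrow> (nat \<Rightarrow> real) \<Rightarrow> (nat \<Rightarrow> 'w \<Rightarrow> real ^ 'd ^ 'd) \<Rightarrow> real \<Rightarrow> 'w \<Rightarrow> real ^ 'd ^ 'd" where
  "simple_process m p \<xi> t \<omega> = (\<Sum>k<m. indicator {p k<..p (Suc k)} t *\<^sub>R \<xi> k \<omega>)"

definition simple_integral ::
  "(real \<Rightarrow> 'w \<Rightarrow> real ^ 'd) \<Rightarrow> nat \<Rightarrow> (nat \<Rightarrow> real) \<Rightarrow> (nat \<Rightarrow> 'w \<Rightarrow> real ^ 'd ^ 'd)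
     \<Rightarrow> real \<Rightarrow> 'w \<Rightarrow> real ^ 'd" where
  "simple_integral B m p \<xi> t \<omega> =
     (\<Sum>k<m. \<xi> k \<omega> *v (B (min t (p (Suc k))) \<omega> - B (min t (p k)) \<omega>))"

definition tends_to_0_in_prob :: "'w measure \<Rightarrow> (nat \<Rightarrow> 'w \<Rightarrow> ennreal) \<Rightarrow> bool" where
  "tends_to_0_in_prob M Z \<longleftrightarrow>
     (\<forall>j. Z j \<in> borel_measurable M) \<and>
     (\<forall>e::real. e > 0 \<longrightarrow> (\<lambda>j. measure M {\<omega> \<in> space M. ennreal e < Z j \<omega>}) \<longlonglongrightarrow> 0)"

text \<open>\<open>is_ito_integral M F B T \<sigma> X\<close> says that \<open>X\<close> is (a version of) the process
  \<open>t \<mapsto> \<integral>\<^sub>0\<^sup>t \<sigma> dB\<close> on \<open>[0, T]\<close>: \<open>\<sigma>\<close> is jointly measurable, adapted and a.s. square-integrable in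
  time, and \<open>X\<close> is the limit, uniformly on \<open>[0, T]\<close> in probability, of the integrals of simple
  integrands that converge to \<open>\<sigma>\<close> in \<open>L\<^sup>2([0, T])\<close> in probability.  By the Ito isometry (localised)
  such a sequence exists for every such \<open>\<sigma>\<close>, the limit does not depend on it up to
  indistinguishability, and it is a continuous local martingale.\<close>

definition is_ito_integral ::
  "'w measure \<Rightarrow> (real \<Rightarrow> 'w measure) \<Rightarrow> (real \<Rightarrow> 'w \<Rightarrow> real ^ 'd) \<Rightarrow> real
     \<Rightarrow> (real \<Rightarrow> 'w \<Rightarrow> real ^ 'd ^ 'd) \<Rightarrow> (real \<Rightarrow> 'w \<Rightarrow> real ^ 'd) \<Rightarrow> bool" where
  "is_ito_integral M F B T \<sigma> X \<longleftrightarrow>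
     (\<lambda>(t, \<omega>). \<sigma> t \<omega>) \<in> borel_measurable (restrict_space borel {0..T} \<Otimes>\<^sub>M M) \<and>
     (\<forall>t \<in> {0..T}. \<sigma> t \<in> borel_measurable (F t)) \<and>
     (AE \<omega> in M. (\<integral>\<^sup>+t\<in>{0..T}. ennreal ((norm (\<sigma> t \<omega>))\<^sup>2) \<partial>lborel) < \<infinity>) \<and>
     (\<forall>t \<in> {0..T}. X t \<in> borel_measurable (F t)) \<and>
     (AE \<omega> in M. continuous_on {0..T} (\<lambda>t. X t \<omega>)) \<and>
     (\<exists>m p \<xi>. (\<forall>j. simple_data F T (m j) (p j) (\<xi> j)) \<and>
        tends_to_0_in_prob M (\<lambda>j \<omega>. \<integral>\<^sup>+t\<in>{0..T}.
          ennreal ((norm (simple_process (m j) (p j) (\<xi> j) t \<omega> - \<sigma> t \<omega>))\<^sup>2) \<partial>lborel) \<and>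
        tends_to_0_in_prob M (\<lambda>j \<omega>. SUP t\<in>{0..T}.
          ennreal (norm (simple_integral B (m j) (p j) (\<xi> j) t \<omega> - X t \<omega>))))"

section \<open>The model\<close>

text \<open>\<open>M\<close> carries the final \<open>\<sigma>\<close>-field of the augmented filtration, so it is complete.\<close>

definition model ::
  "'w measure \<Rightarrow> real \<Rightarrow> (real \<Rightarrow> 'w \<Rightarrow> real ^ 'd) \<Rightarrow> (real \<Rightarrow> 'w \<Rightarrow> real ^ 'd ^ 'd)
     \<Rightarrow> (real \<Rightarrow> 'w \<Rightarrow> real ^ 'd) \<Rightarrow> bool" where
  "model M T B \<sigma> S \<longleftrightarrow>
     0 < T \<and> brownian_motion M T B \<and>
     sets M = sets (augmented_filtration M T B T) \<and>
     S 0 \<in> borel_measurable (augmented_filtration M T B 0) \<and>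
     is_ito_integral M (augmented_filtration M T B) B T \<sigma> (\<lambda>t \<omega>. S t \<omega> - S 0 \<omega>)"

text \<open>\<open>norm\<close> on matrices is the Frobenius norm; the norm induced by the Euclidean one is
  \<open>onorm\<close>.\<close>

definition cond_A_sigma ::
  "'w measure \<Rightarrow> real \<Rightarrow> (real \<Rightarrow> 'w \<Rightarrow> real ^ 'd ^ 'd) \<Rightarrow> (real \<Rightarrow> 'w \<Rightarrow> real ^ 'd) \<Rightarrow> real \<Rightarrow> bool" where
  "cond_A_sigma M T \<sigma> S \<theta> \<longleftrightarrow>
     (AE \<omega> in M. \<forall>t \<in> {0..T}. \<sigma> t \<omega> \<noteq> 0) \<and>
     0 < \<theta> \<and> \<theta> \<le> 1 \<and>
     (\<exists>C\<^sub>0 \<in> borel_measurable M. (\<forall>\<omega>. (0::real) \<le> C\<^sub>0 \<omega>) \<and>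
        (AE \<omega> in M. \<forall>s \<in> {0..T}. \<forall>t \<in> {0..T}.
           onorm ((*v) (\<sigma> t \<omega> - \<sigma> s \<omega>))
             \<le> C\<^sub>0 \<omega> * (norm (S t \<omega> - S s \<omega>) powr \<theta> + \<bar>t - s\<bar> powr (\<theta> / 2))))"

section \<open>Discretization strategies\<close>

definition step_sizes :: "(nat \<Rightarrow> real) \<Rightarrow> bool" where
  "step_sizes \<epsilon> \<longleftrightarrow> (\<forall>n. 0 < \<epsilon> n) \<and> \<epsilon> \<longlonglongrightarrow> 0 \<and> summable (\<lambda>n. (\<epsilon> n)\<^sup>2)"

text \<open>\<open>\<tau> n i\<close> is the \<open>i\<close>-th time of the \<open>n\<close>-th strategy and \<open>N n\<close> its number of intervals.  So that
  \<open>\<tau> n i\<close> is a random time for every \<open>i\<close>, the sequence is continued by \<open>T\<close> after index \<open>N n\<close>.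
  As \<open>N n\<close> takes values in \<open>nat\<close> and the description of the grid is only required almost surely,
  this says that the grid is a.s. finite; the value of \<open>N n\<close> on the exceptional null set is
  irrelevant.\<close>

definition strategies ::
  "'w measure \<Rightarrow> (real \<Rightarrow> 'w measure) \<Rightarrow> real \<Rightarrow> (nat \<Rightarrow> nat \<Rightarrow> 'w \<Rightarrow> real)
     \<Rightarrow> (nat \<Rightarrow> 'w \<Rightarrow> nat) \<Rightarrow> bool" where
  "strategies M F T \<tau> N \<longleftrightarrow>
     (\<forall>n i. stopping_time F (\<tau> n i)) \<and>
     (\<forall>n. AE \<omega> in M. \<tau> n 0 \<omega> = 0 \<and> (\<forall>i < N n \<omega>. \<tau> n i \<omega> < \<tau> n (Suc i) \<omega>) \<and>
        (\<forall>i \<ge> N n \<omega>. \<tau> n i \<omega> = T))"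

definition cond_A_N ::
  "'w measure \<Rightarrow> (nat \<Rightarrow> real) \<Rightarrow> (nat \<Rightarrow> 'w \<Rightarrow> nat) \<Rightarrow> real \<Rightarrow> real \<Rightarrow> bool" where
  "cond_A_N M \<epsilon> N \<theta> \<rho>\<^sub>N \<longleftrightarrow>
     1 \<le> \<rho>\<^sub>N \<and> \<rho>\<^sub>N < min (1 + \<theta> / 2) (4 / 3) \<and>
     (AE \<omega> in M. (SUP n. ennreal (\<epsilon> n powr (2 * \<rho>\<^sub>N) * real (N n \<omega>))) < \<infinity>)"

definition cond_A_S ::
  "'w measure \<Rightarrow> (nat \<Rightarrow> real) \<Rightarrow> (real \<Rightarrow> 'w \<Rightarrow> real ^ 'd) \<Rightarrow> (nat \<Rightarrow> nat \<Rightarrow> 'w \<Rightarrow> real)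
     \<Rightarrow> (nat \<Rightarrow> 'w \<Rightarrow> nat) \<Rightarrow> bool" where
  "cond_A_S M \<epsilon> S \<tau> N \<longleftrightarrow>
     (AE \<omega> in M. (SUP n. ennreal (\<epsilon> n powr - 2) *
        (SUP i\<in>{1..N n \<omega>}. SUP t\<in>{\<tau> n (i - 1) \<omega><..\<tau> n i \<omega>}.
           ennreal ((norm (S t \<omega> - S (\<tau> n (i - 1) \<omega>) \<omega>))\<^sup>2))) < \<infinity>)"

definition max_step :: "(nat \<Rightarrow> nat \<Rightarrow> 'w \<Rightarrow> real) \<Rightarrow> (nat \<Rightarrow> 'w \<Rightarrow> nat) \<Rightarrow> nat \<Rightarrow> 'w \<Rightarrow> ennreal" where
  "max_step \<tau> N n \<omega> = (SUP i\<in>{1..N n \<omega>}. ennreal (\<tau> n i \<omega> - \<tau> n (i - 1) \<omega>))"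

end

theory Submission
  imports Defs
begin

text \<open>Both bounds follow from a lower bound on the oscillation of \<open>S\<close> alone: for every \<open>\<eta> > 0\<close>, almost surely,
  for all large \<open>n\<close>, \<open>S\<close> moves by more than \<open>n powr - (1/2 + \<eta>)\<close> on each of the intervals
  \<open>[k T/n, (k+1) T/n]\<close>.  An interval on which \<open>S\<close> moves by \<open>O(\<epsilon>)\<close> then has length
  \<open>O(\<epsilon> powr (2/(1 + 2\<eta>)))\<close>.

  For a coordinate \<open>Y\<close> of a stochastic integral with quadratic variation \<open>A\<close>, both started at \<open>0\<close>,
  the process \<open>(4 \<delta>\<^sup>2 - Y\<^sup>2) exp (A / (8 \<delta>\<^sup>2))\<close>, killed when \<open>|Y|\<close> exceeds \<open>\<delta>\<close>, is a
  supermartingale, so the event that \<open>|Y| \<le> \<delta>\<close> throughout while \<open>A \<ge> b\<close> has probability at most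
  \<open>4/3 exp (- b / (8 \<delta>\<^sup>2))\<close>.  For simple integrands this needs only moments of Gaussian increments; it
  passes to general integrands by convergence in probability.  As \<open>\<sigma>\<close> is continuous and never
  \<open>0\<close>, on each interval of length \<open>T/n\<close> some coordinate has \<open>b\<close> of order \<open>1/n\<close>, and the
  Borel--Cantelli lemma with \<open>\<delta> = n powr - (1/2 + \<eta>)\<close> concludes.\<close>

section \<open>Gaussian moments\<close>

text \<open>While |Y| \<le> \<delta>, the quantity 4 \<delta>^2 - Y^2 lies between 3 \<delta>^2 and
  4 \<delta>^2, so its drift - dA is at most - (4 \<delta>^2 - Y^2) dA / (4 \<delta>^2). This alone
  would allow the exponential rate 1 / (4 \<delta>^2). Half of it is given up, because killing is
  tested only at discrete times and the other half of the drift has to pay for the overshoot.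

  The stochastic integral is given only as a limit in probability of simple integrals, whose
  integrands need not share a bound or a partition. The exit estimate must therefore have constants
  that depend on neither: for each simple integrand time is divided so finely that the steps are
  small compared with its bound, and the bound then disappears from the result. The limit only costs
  a factor 16 in the exponent.

  Borel--Cantelli needs deterministic thresholds, but the minimum of |\<sigma>| along a path is
  random. So the size of the quadratic variation is made part of the event, and countably many
  thresholds cover all paths.\<close>

lemma lborel_product:
  fixes f :: "'a::euclidean_space \<Rightarrow> real \<Rightarrow> real"
  assumes int: "\<And>b. b \<in> Basis \<Longrightarrow> integrable lborel (f b)"
  shows "integrable lborel (\<lambda>x::'a. \<Prod>b\<in>Basis. f b (x \<bullet> b))"
    and "(\<integral>x. (\<Prod>b\<in>Basis. f b (x \<bullet> b)) \<partial>(lborel :: 'a measure)) = (\<Prod>b\<in>Basis. \<integral>y. f b y \<partial>lborel)"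
proof -
  interpret product_sigma_finite "\<lambda>_. lborel :: real measure"
    by standard
  have [measurable]: "\<And>b. b \<in> Basis \<Longrightarrow> f b \<in> borel_measurable borel"
    using int by (auto dest: borel_measurable_integrable)
  have coord: "(\<Sum>c\<in>Basis. g c *\<^sub>R c) \<bullet> b = g b" if "b \<in> Basis" for g and b :: 'a
    using that by (simp add: inner_sum_left_Basis)
  have m: "(\<lambda>g. \<Sum>b\<in>Basis. g b *\<^sub>R b) \<in> (\<Pi>\<^sub>M b\<in>(Basis::'a set). lborel) \<rightarrow>\<^sub>M borel"
    by measurable
  \<comment> \<open>Lebesgue measure on \<open>'a\<close> is the image of a product of
    one-dimensional ones under the map from coordinates to vectors; this reduces both claims to
    Fubini on the product.\<close>
  show "integrable lborel (\<lambda>x::'a. \<Prod>b\<in>Basis. f b (x \<bullet> b))"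
    using product_integrable_prod[OF finite_Basis int]
    by (subst lborel_eq, subst integrable_distr_eq[OF m]) (auto simp: coord)
  show "(\<integral>x. (\<Prod>b\<in>Basis. f b (x \<bullet> b)) \<partial>(lborel :: 'a measure)) = (\<Prod>b\<in>Basis. \<integral>y. f b y \<partial>lborel)"
    using product_integral_prod[OF finite_Basis int]
    by (subst lborel_eq, subst integral_distr[OF m]) (auto simp: coord)
qed

lemma lborel_vec_product:
  fixes f :: "'d::finite \<Rightarrow> real \<Rightarrow> real"
  assumes int: "\<And>j. integrable lborel (f j)"
  shows "integrable lborel (\<lambda>x::real^'d. \<Prod>j\<in>UNIV. f j (x $ j))"
    and "(\<integral>x. (\<Prod>j\<in>UNIV. f j (x $ j)) \<partial>(lborel :: (real^'d) measure)) = (\<Prod>j\<in>UNIV. \<integral>y. f j y \<partial>lborel)"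
proof -
  let ?a = "\<lambda>j::'d. axis j (1::real)"
  \<comment> \<open>The basis vectors are the \<open>axis j 1\<close>; undoing this enumeration
    turns a family indexed by \<open>'d\<close> into one indexed by \<open>Basis\<close>.\<close>
  define F where "F b = f (inv ?a b)" for b
  have inj: "inj ?a"
    by (auto simp: inj_def axis_eq_axis)
  have B: "(Basis :: (real^'d) set) = range ?a"
    by (auto simp: Basis_vec_def)
  have F: "F (?a j) = f j" for j
    by (simp add: F_def inv_f_f[OF inj])
  have *: "(\<Prod>b\<in>Basis. F b (x \<bullet> b)) = (\<Prod>j\<in>UNIV. f j (x $ j))" for x :: "real^'d"
    unfolding B by (subst prod.reindex[OF inj]) (simp add: F inner_axis)
  have **: "(\<Prod>b\<in>(Basis::(real^'d) set). \<integral>y. F b y \<partial>lborel) = (\<Prod>j\<in>UNIV. \<integral>y. f j y \<partial>lborel)"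
    unfolding B by (subst prod.reindex[OF inj]) (simp add: F)
  have i: "integrable lborel (F b)" for b
    using int by (simp add: F_def)
  show "integrable lborel (\<lambda>x::real^'d. \<Prod>j\<in>UNIV. f j (x $ j))"
    using lborel_product(1)[of F, OF i] by (simp add: *)
  show "(\<integral>x. (\<Prod>j\<in>UNIV. f j (x $ j)) \<partial>(lborel :: (real^'d) measure)) = (\<Prod>j\<in>UNIV. \<integral>y. f j y \<partial>lborel)"
    using lborel_product(2)[of F, OF i] by (simp add: * **)
qed

lemma normal_product_moments:
  fixes X :: "'w \<Rightarrow> real ^ 'd::finite" and e :: "'d \<Rightarrow> nat"
  assumes X: "distributed M lborel X (\<lambda>x. ennreal (\<Prod>j\<in>UNIV. normal_density 0 s (x $ j)))"
    and "s > 0"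
  shows "integrable M (\<lambda>\<omega>. \<Prod>j\<in>UNIV. (X \<omega> $ j) ^ e j)"
    and "(\<integral>\<omega>. (\<Prod>j\<in>UNIV. (X \<omega> $ j) ^ e j) \<partial>M) = (\<Prod>j\<in>UNIV. \<integral>y. normal_density 0 s y * y ^ e j \<partial>lborel)"
proof -
  have i: "integrable lborel (\<lambda>y. normal_density 0 s y * y ^ e j)" for j
    using integrable_normal_moment[OF \<open>s > 0\<close>, of 0 "e j"] by simp
  have nn: "0 \<le> (\<Prod>j\<in>UNIV. normal_density 0 s (x $ j))" for x :: "real^'d"
    by (intro prod_nonneg) auto
  have m: "(\<lambda>x::real^'d. \<Prod>j\<in>UNIV. (x $ j) ^ e j) \<in> borel_measurable lborel"
    by measurable
  note v = lborel_vec_product[of "\<lambda>j y. normal_density 0 s y * y ^ e j", OF i, unfolded prod.distrib]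
  show "integrable M (\<lambda>\<omega>. \<Prod>j\<in>UNIV. (X \<omega> $ j) ^ e j)"
    using distributed_integrable[OF X m nn] v(1) by simp
  show "(\<integral>\<omega>. (\<Prod>j\<in>UNIV. (X \<omega> $ j) ^ e j) \<partial>M) = (\<Prod>j\<in>UNIV. \<integral>y. normal_density 0 s y * y ^ e j \<partial>lborel)"
    using distributed_integral[OF X m nn] v(2) by simp
qed

lemma normal_vector_moments:
  fixes X :: "'w \<Rightarrow> real ^ 'd::finite"
  assumes X: "distributed M lborel X (\<lambda>x. ennreal (\<Prod>j\<in>UNIV. normal_density 0 s (x $ j)))"
    and s: "s > 0"
  shows "has_bochner_integral M (\<lambda>\<omega>. X \<omega> $ i) 0"
    and "has_bochner_integral M (\<lambda>\<omega>. X \<omega> $ i * X \<omega> $ j) (if i = j then s\<^sup>2 else 0)"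
    and "has_bochner_integral M (\<lambda>\<omega>. (X \<omega> $ i) ^ 4) (3 * s ^ 4)"
proof -
  define m where "m k = (\<integral>y. normal_density 0 s y * y ^ k \<partial>lborel)" for k :: nat
  have m: "m 0 = 1" "m (Suc 0) = 0" "m 2 = s\<^sup>2" "m 4 = 3 * s ^ 4"
    using integral_normal_moment_even[OF s, of 0 0] integral_normal_moment_odd[OF s, of 0 0]
      integral_normal_moment_even[OF s, of 0 1] integral_normal_moment_even[OF s, of 0 2]
    by (simp_all add: m_def fact_numeral power_divide)
  have hb: "has_bochner_integral M (\<lambda>\<omega>. \<Prod>j\<in>UNIV. (X \<omega> $ j) ^ e j) (\<Prod>j\<in>UNIV. m (e j))" for e
    using normal_product_moments[OF X s, of e] by (simp add: has_bochner_integral_iff m_def)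
  have single: "has_bochner_integral M (\<lambda>\<omega>. (X \<omega> $ i) ^ k) (m k)" for k
  proof -
    \<comment> \<open>Used for the moments and for the powers of the coordinates. In both cases
      exponent 0 gives the factor 1, so only index \<open>i\<close> survives.\<close>
    have "(\<Prod>j\<in>UNIV. h j (if j = i then k else 0)) = h i k" if "\<And>j. h j 0 = 1" for h :: "'d \<Rightarrow> nat \<Rightarrow> real"
      using that by (subst prod.remove[of _ i]) (auto intro!: prod.neutral)
    from this[of "\<lambda>_. m"] this[of "\<lambda>j k. (X \<omega> $ j) ^ k" for \<omega>] show ?thesis
      using hb[of "\<lambda>j. if j = i then k else 0"] m by simp
  qed
  show "has_bochner_integral M (\<lambda>\<omega>. X \<omega> $ i) 0"
    using single[of 1] m by simp
  show "has_bochner_integral M (\<lambda>\<omega>. (X \<omega> $ i) ^ 4) (3 * s ^ 4)"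
    using single[of 4] m by simp
  show "has_bochner_integral M (\<lambda>\<omega>. X \<omega> $ i * X \<omega> $ j) (if i = j then s\<^sup>2 else 0)"
  proof (cases "i = j")
    case True
    then show ?thesis using single[of 2] m by (simp add: power2_eq_square)
  next
    case False
    have pr: "(\<Prod>l\<in>UNIV. h l (if l = i \<or> l = j then 1 else 0)) = h i 1 * h j 1"
      if "\<And>j. h j 0 = 1" for h :: "'d \<Rightarrow> nat \<Rightarrow> real"
      using that False
      by (subst prod.remove[of _ i], simp, simp, subst prod.remove[of _ j]) (auto intro!: prod.neutral)
    \<comment> \<open>The mixed moment is a product of two first moments, which vanish.\<close>
    show ?thesis
      using hb[of "\<lambda>l. if l = i \<or> l = j then 1 else 0"] m(2) False
      unfolding pr[of "\<lambda>_. m", OF m(1)] pr[of "\<lambda>j k. (X \<omega> $ j) ^ k" for \<omega>, OF power_0]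
      by simp
  qed
qed

section \<open>Independence of Brownian increments from the augmented filtration\<close>

lemma space_natural_filtration [simp]: "space (natural_filtration M T B t) = space M"
  by (simp add: natural_filtration_def space_measure_of_conv)

lemma space_augmented_filtration [simp]: "space (augmented_filtration M T B t) = space M"
  by (simp add: augmented_filtration_def space_measure_of_conv)

lemma sets_natural_filtration:
  "sets (natural_filtration M T B t) =
     sigma_sets (space M) {B s -` A \<inter> space M | s A. s \<in> {0..min t T} \<and> A \<in> sets borel}"
  unfolding natural_filtration_def by (rule sets_measure_of) auto

lemma sets_augmented_filtration:
  "sets (augmented_filtration M T B t) =
     sigma_sets (space M) (sets (natural_filtration M T B t) \<union> negligible_sets M T B)"
  unfolding augmented_filtration_def
  by (rule sets_measure_of)
    (auto simp: negligible_sets_def dest!: sets.sets_into_space)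

lemma sets_natural_filtration_mono:
  "s \<le> t \<Longrightarrow> sets (natural_filtration M T B s) \<subseteq> sets (natural_filtration M T B t)"
  unfolding sets_natural_filtration by (rule sigma_sets_mono') fastforce

lemma sets_augmented_filtration_mono:
  "s \<le> t \<Longrightarrow> sets (augmented_filtration M T B s) \<subseteq> sets (augmented_filtration M T B t)"
  unfolding sets_augmented_filtration
  using sets_natural_filtration_mono by (intro sigma_sets_mono') blast

lemma sets_natural_subset_augmented:
  "sets (natural_filtration M T B t) \<subseteq> sets (augmented_filtration M T B t)"
  unfolding sets_augmented_filtration by auto

lemma borel_measurable_augmented_mono:
  assumes "s \<le> t" "f \<in> borel_measurable (augmented_filtration M T B s)"
  shows "f \<in> borel_measurable (augmented_filtration M T B t)"
  using assms sets_augmented_filtration_mono[OF assms(1), of M T B]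
  by (auto simp: measurable_def)

lemma brownian_adapted:
  fixes B :: "real \<Rightarrow> 'w \<Rightarrow> real ^ 'd::finite"
  assumes "s \<in> {0..T}" "s \<le> t"
  shows "B s \<in> borel_measurable (augmented_filtration M T B t)"
proof (rule measurableI)
  fix A :: "(real ^ 'd) set" assume "A \<in> sets borel"
  then have "B s -` A \<inter> space M \<in> sets (natural_filtration M T B t)"
    unfolding sets_natural_filtration using assms by (intro sigma_sets.Basic) auto
  then show "B s -` A \<inter> space (augmented_filtration M T B t) \<in> sets (augmented_filtration M T B t)"
    using subsetD[OF sets_natural_subset_augmented] by simp
qed simp

text \<open>The sets that agree with a set of the natural filtration up to a null set form a
  \<sigma>-algebra, and it contains the negligible sets. This lets independence pass to the
  augmented filtration.\<close>

lemma augmented_set_approx: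
  assumes M: "sets M = sets (augmented_filtration M T B T)" and "t \<le> T"
    and A: "A \<in> sets (augmented_filtration M T B t)"
  shows "\<exists>A' \<in> sets (natural_filtration M T B t). \<exists>G \<in> null_sets M. A - A' \<subseteq> G \<and> A' - A \<subseteq> G"
  using A unfolding sets_augmented_filtration
proof (induction rule: sigma_sets.induct)
  case (Basic a)
  then show ?case
  proof
    assume "a \<in> negligible_sets M T B"
    then obtain G where "G \<in> sets (natural_filtration M T B T)" "a \<subseteq> G" "emeasure M G = 0"
      by (auto simp: negligible_sets_def)
    moreover from this have "G \<in> sets M"
      using M sets_natural_subset_augmented by blast
    ultimately show ?thesis
      by (intro bexI[of _ "{}"] bexI[of _ G]) auto
  qed auto
next
  case Empty
  then show ?case by auto
next
  case (Compl a)
  then obtain A' G where *: "A' \<in> sets (natural_filtration M T B t)" "G \<in> null_sets M"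
    "a - A' \<subseteq> G" "A' - a \<subseteq> G" by blast
  have "space M - A' \<in> sets (natural_filtration M T B t)"
    using *(1) by (metis sets.compl_sets space_natural_filtration)
  with * show ?case
    by (intro bexI[of _ "space M - A'"] bexI[of _ G]) auto
next
  case (Union a)
  then obtain A' G where *: "\<And>i::nat. A' i \<in> sets (natural_filtration M T B t)" "\<And>i. G i \<in> null_sets M"
    "\<And>i. a i - A' i \<subseteq> G i" "\<And>i. A' i - a i \<subseteq> G i" by metis
  have "(\<Union>i. G i) \<in> null_sets M"
    using *(2) by (intro null_sets_UN) auto
  moreover have "(\<Union>i. A' i) \<in> sets (natural_filtration M T B t)"
    using *(1) by auto
  moreover have "(\<Union>i. a i) - (\<Union>i. A' i) \<subseteq> (\<Union>i. G i)" "(\<Union>i. A' i) - (\<Union>i. a i) \<subseteq> (\<Union>i. G i)"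
    using *(3,4) by fastforce+
  ultimately show ?case by blast
qed

text \<open>Conditioning on the past, in expectation form. \<open>V\<close> is what is known at time
  \<open>s\<close>; \<open>f\<close> will be a coordinate, a product of two coordinates or the
  fourth power of a coordinate.\<close>

lemma augmented_indep_increment:
  fixes B :: "real \<Rightarrow> 'w \<Rightarrow> real ^ 'd::finite" and V :: "'w \<Rightarrow> real"
  assumes B: "brownian_motion M T B" and M: "sets M = sets (augmented_filtration M T B T)"
    and st: "0 \<le> s" "s < t" "t \<le> T"
    and V: "V \<in> borel_measurable (augmented_filtration M T B s)" "integrable M V"
    and f: "f \<in> borel_measurable borel" "has_bochner_integral M (\<lambda>\<omega>. f (B t \<omega> - B s \<omega>)) c"
  shows "has_bochner_integral M (\<lambda>\<omega>. V \<omega> * f (B t \<omega> - B s \<omega>)) ((\<integral>\<omega>. V \<omega> \<partial>M) * c)"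
proof -
  interpret prob_space M using B by (simp add: brownian_motion_def)
  let ?N = "sets (natural_filtration M T B s)" and ?F = "sets (augmented_filtration M T B s)"
  let ?D = "{(\<lambda>\<omega>. B t \<omega> - B s \<omega>) -` A \<inter> space M | A. A \<in> sets borel}"
  have ind: "indep_set ?N ?D"
    using B st by (simp add: brownian_motion_def)
  have FM: "?F \<subseteq> sets M"
    using sets_augmented_filtration_mono[of s T M T B] st M by simp
  have "indep_set ?F ?D"
  proof (rule indep_setI)
    show "?F \<subseteq> events" "?D \<subseteq> events"
      using FM indep_setD_ev2[OF ind] by auto
    fix a b assume a: "a \<in> ?F" and b: "b \<in> ?D"
    obtain a' G where a': "a' \<in> ?N" "G \<in> null_sets M" "a - a' \<subseteq> G" "a' - a \<subseteq> G"
      using augmented_set_approx[OF M _ a] st by auto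
    have bM: "b \<in> sets M" and a'M: "a' \<in> sets M" and aM: "a \<in> sets M"
      using subsetD[OF indep_setD_ev2[OF ind] b] subsetD[OF indep_setD_ev1[OF ind] a'(1)] subsetD[OF FM a] .
    have "AE x in M. x \<notin> G" using a'(2) by (rule AE_not_in)
    \<comment> \<open>Replacing \<open>a\<close> by \<open>a'\<close> changes neither its
      probability nor that of its intersection with \<open>b\<close>, so the product rule is
      inherited from the natural filtration.\<close>
    then have ae: "AE x in M. x \<in> a \<longleftrightarrow> x \<in> a'"
      by (rule eventually_mono) (use a'(3,4) in blast)
    then have "prob a = prob a'"
      using aM a'M by (rule measure_eq_AE)
    moreover have "AE x in M. x \<in> a \<inter> b \<longleftrightarrow> x \<in> a' \<inter> b"
      using ae by (rule eventually_mono) simp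
    then have "prob (a \<inter> b) = prob (a' \<inter> b)"
      using aM a'M bM by (intro measure_eq_AE) auto
    ultimately show "prob (a \<inter> b) = prob a * prob b"
      using indep_setD[OF ind a'(1) b] by simp
  qed
  then have ind': "indep_sets (case_bool ?F ?D) UNIV"
    by (simp add: indep_set_def)
  have Bm: "B s \<in> borel_measurable M" "B t \<in> borel_measurable M"
    using B st by (auto simp: brownian_motion_def)
  have Vm: "V \<in> borel_measurable M" using V by auto
  have fm: "(\<lambda>\<omega>. f (B t \<omega> - B s \<omega>)) \<in> borel_measurable M"
    using f Bm by measurable
  let ?f = "\<lambda>\<omega>. f (B t \<omega> - B s \<omega>)"
  have iv: "indep_var borel V borel ?f"
    unfolding indep_var_eq
  proof (intro conjI Vm fm)
    have "sigma_sets (space M) {V -` A \<inter> space M |A. A \<in> sets borel} \<subseteq> ?F"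
    proof -
      have "{V -` A \<inter> space M |A. A \<in> sets borel} \<subseteq> ?F"
        using measurable_sets[OF V(1)] by auto
      from sets.sigma_sets_subset[OF this] show ?thesis by simp
    qed
    moreover have "sigma_sets (space M) {?f -` A \<inter> space M |A. A \<in> sets borel} \<subseteq> ?D"
    proof -
      have eq: "{?f -` A \<inter> space M |A. A \<in> sets borel} \<subseteq> ?D"
      proof clarify
        fix A :: "real set" assume "A \<in> sets borel"
        then have "f -` A \<in> sets borel" using f(1) measurable_sets_borel by blast
        then show "\<exists>A'. ?f -` A \<inter> space M = (\<lambda>\<omega>. B t \<omega> - B s \<omega>) -` A' \<inter> space M \<and> A' \<in> sets borel"
          by (intro exI[of _ "f -` A"]) auto
      qed
      \<comment> \<open>\<open>?D\<close> is itself a \<sigma>-algebra, the one generated by the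
        increment, so it contains all that a Borel function of the increment generates.\<close>
      have "?D = sets (vimage_algebra (space M) (\<lambda>\<omega>. B t \<omega> - B s \<omega>) borel)"
        by (simp add: sets_vimage_algebra2)
      then show ?thesis using eq
        by (metis (no_types, lifting) sets.sigma_sets_subset space_vimage_algebra)
    qed
    ultimately show "indep_set (sigma_sets (space M) {V -` A \<inter> space M |A. A \<in> sets borel})
        (sigma_sets (space M) {?f -` A \<inter> space M |A. A \<in> sets borel})"
      unfolding indep_set_def by (intro indep_sets_mono_sets[OF ind']) (auto split: bool.split)
  qed
  have fi: "integrable M ?f" "integral\<^sup>L M ?f = c"
    using f(2) by (auto simp: has_bochner_integral_iff)
  show ?thesis
    using indep_var_integrable[OF iv V(2) fi(1)] indep_var_lebesgue_integral[OF iv V(2) fi(1)] fi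
    by (simp add: has_bochner_integral_iff)
qed

section \<open>Bounded random variables known at a given time\<close>

text \<open>The weights by which later increments are multiplied: measurability at the given time
  makes them independent of those increments, boundedness makes the products integrable.\<close>

definition bounded_borel :: "'w measure \<Rightarrow> ('w \<Rightarrow> 'b::real_normed_vector) set" where
  "bounded_borel F = {f \<in> borel_measurable F. \<exists>C. \<forall>\<omega>\<in>space F. norm (f \<omega>) \<le> C}"

lemma bounded_borelI:
  "f \<in> borel_measurable F \<Longrightarrow> (\<And>\<omega>. \<omega> \<in> space F \<Longrightarrow> norm (f \<omega>) \<le> C) \<Longrightarrow> f \<in> bounded_borel F"
  by (auto simp: bounded_borel_def)

lemma bounded_borelE:
  assumes "f \<in> bounded_borel F"
  obtains C where "f \<in> borel_measurable F" "0 \<le> C" "\<And>\<omega>. \<omega> \<in> space F \<Longrightarrow> norm (f \<omega>) \<le> C"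
proof -
  obtain C where C: "\<And>\<omega>. \<omega> \<in> space F \<Longrightarrow> norm (f \<omega>) \<le> C" and f: "f \<in> borel_measurable F"
    using assms by (auto simp: bounded_borel_def)
  show ?thesis
    \<comment> \<open>\<open>C\<close> can be negative if \<open>space F\<close> is empty.\<close>
    by (rule that[OF f, of "max 0 C"]) (use C in \<open>auto simp: le_max_iff_disj\<close>)
qed

lemma bounded_borel_mult:
  fixes f g :: "'w \<Rightarrow> real"
  assumes "f \<in> bounded_borel F" "g \<in> bounded_borel F"
  shows "(\<lambda>\<omega>. f \<omega> * g \<omega>) \<in> bounded_borel F"
proof -
  obtain C where C: "f \<in> borel_measurable F" "0 \<le> C" "\<And>\<omega>. \<omega> \<in> space F \<Longrightarrow> norm (f \<omega>) \<le> C"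
    using assms(1) by (rule bounded_borelE) blast
  obtain D where D: "g \<in> borel_measurable F" "0 \<le> D" "\<And>\<omega>. \<omega> \<in> space F \<Longrightarrow> norm (g \<omega>) \<le> D"
    using assms(2) by (rule bounded_borelE) blast
  show ?thesis
    using C D by (intro bounded_borelI[of _ _ "C * D"]) (auto simp: abs_mult intro!: mult_mono)
qed

lemma bounded_borel_norm_power:
  fixes w :: "'w \<Rightarrow> 'b::{real_normed_vector, second_countable_topology}"
  assumes "w \<in> bounded_borel F"
  shows "(\<lambda>\<omega>. norm (w \<omega>) ^ k) \<in> bounded_borel F"
proof -
  obtain C where C: "w \<in> borel_measurable F" "0 \<le> C" "\<And>\<omega>. \<omega> \<in> space F \<Longrightarrow> norm (w \<omega>) \<le> C"
    using assms(1) by (rule bounded_borelE) blast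
  show ?thesis
    using C by (intro bounded_borelI[of _ _ "C ^ k"]) (auto simp: intro!: power_mono)
qed

lemma borel_measurable_vec_nth:
  fixes f :: "'w \<Rightarrow> 'b::euclidean_space ^ 'd::finite"
  assumes "f \<in> borel_measurable F"
  shows "(\<lambda>\<omega>. f \<omega> $ i) \<in> borel_measurable F"
  using assms
  by (rule measurable_compose) (intro borel_measurable_continuous_onI continuous_intros)

lemma bounded_borel_nth:
  fixes w :: "'w \<Rightarrow> 'b::euclidean_space ^ 'd::finite"
  assumes "w \<in> bounded_borel F"
  shows "(\<lambda>\<omega>. w \<omega> $ i) \<in> bounded_borel F"
proof -
  obtain C where C: "w \<in> borel_measurable F" "0 \<le> C" "\<And>\<omega>. \<omega> \<in> space F \<Longrightarrow> norm (w \<omega>) \<le> C"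
    using assms(1) by (rule bounded_borelE) blast
  show ?thesis
    using C borel_measurable_vec_nth[OF C(1)] by (intro bounded_borelI[of _ _ C]) (auto intro: order_trans[OF Finite_Cartesian_Product.norm_nth_le])
qed

lemma bounded_borel_integrable:
  assumes "prob_space M" "sets F \<subseteq> sets M" "space F = space M"
    and f: "f \<in> bounded_borel F"
  shows "integrable M (f :: 'w \<Rightarrow> real)"
proof -
  interpret prob_space M by fact
  obtain C where C: "f \<in> borel_measurable F" "\<And>\<omega>. \<omega> \<in> space F \<Longrightarrow> norm (f \<omega>) \<le> C"
    using f by (rule bounded_borelE) blast
  have "f \<in> borel_measurable M"
    using C(1) assms by (auto simp: measurable_def)
  then show ?thesis
    using C(2) assms by (intro integrable_const_bound[of _ C]) auto
qed

text \<open>Cauchy--Schwarz for the squared coordinates. It reduces the fourth moment of an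
  increment to those of its coordinates at the cost of a dimension factor.\<close>

lemma norm_pow4_le:
  fixes x :: "real ^ 'd::finite"
  shows "norm x ^ 4 \<le> CARD('d) * (\<Sum>i\<in>UNIV. (x $ i) ^ 4)"
proof -
  have "norm x ^ 4 = (norm x ^ 2) ^ 2" by simp
  also have "\<dots> = (\<Sum>i\<in>UNIV. (x $ i) ^ 2) ^ 2"
    by (simp add: norm_vec_def L2_set_def sum_nonneg)
  also have "\<dots> \<le> CARD('d) * (\<Sum>i\<in>UNIV. ((x $ i) ^ 2) ^ 2)"
    using sum_squared_le_sum_of_squares[of "\<lambda>i. (x $ i)\<^sup>2" UNIV] by (simp add: mult.commute)
  finally show ?thesis by simp
qed

section \<open>Brownian increments weighted by the past\<close>

locale brownian =
  fixes M :: "'w measure" and T :: real and B :: "real \<Rightarrow> 'w \<Rightarrow> real ^ 'd::finite"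
  assumes brownian: "brownian_motion M T B"
    and sets_M: "sets M = sets (augmented_filtration M T B T)"
begin

sublocale prob_space M
  using brownian by (simp add: brownian_motion_def)

abbreviation "F t \<equiv> augmented_filtration M T B t"

lemma sets_F_le: "t \<le> T \<Longrightarrow> sets (F t) \<subseteq> sets M"
  using sets_augmented_filtration_mono[of t T M T B] sets_M by simp

lemma measurable_F: "t \<le> T \<Longrightarrow> f \<in> borel_measurable (F t) \<Longrightarrow> f \<in> borel_measurable M"
  using sets_F_le[of t] by (auto simp: measurable_def)

lemma bounded_borel_F_mono:
  "s \<le> t \<Longrightarrow> f \<in> bounded_borel (F s) \<Longrightarrow> f \<in> bounded_borel (F t)"
  by (auto simp: bounded_borel_def intro: borel_measurable_augmented_mono)

lemma integrable_bounded_borel: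
  "t \<le> T \<Longrightarrow> f \<in> bounded_borel (F t) \<Longrightarrow> integrable M (f :: 'w \<Rightarrow> real)"
  by (rule bounded_borel_integrable[OF prob_space_axioms sets_F_le]) auto

lemma increment_moments:
  assumes "0 \<le> s" "s < t" "t \<le> T"
  shows "has_bochner_integral M (\<lambda>\<omega>. (B t \<omega> - B s \<omega>) $ i) 0"
    and "has_bochner_integral M (\<lambda>\<omega>. (B t \<omega> - B s \<omega>) $ i * (B t \<omega> - B s \<omega>) $ j) (if i = j then t - s else 0)"
    and "has_bochner_integral M (\<lambda>\<omega>. ((B t \<omega> - B s \<omega>) $ i) ^ 4) (3 * (t - s)\<^sup>2)"
proof -
  have d: "distributed M lborel (\<lambda>\<omega>. B t \<omega> - B s \<omega>)
      (\<lambda>x. ennreal (\<Prod>j\<in>UNIV. normal_density 0 (sqrt (t - s)) (x $ j)))"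
    using brownian assms by (auto simp: brownian_motion_def)
  have s: "0 < sqrt (t - s)" using assms by simp
  have "sqrt (t - s) ^ 4 = ((sqrt (t - s))\<^sup>2)\<^sup>2" by simp
  then have p: "(sqrt (t - s))\<^sup>2 = t - s" "sqrt (t - s) ^ 4 = (t - s)\<^sup>2"
    using assms by simp_all
  show "has_bochner_integral M (\<lambda>\<omega>. (B t \<omega> - B s \<omega>) $ i) 0"
    "has_bochner_integral M (\<lambda>\<omega>. (B t \<omega> - B s \<omega>) $ i * (B t \<omega> - B s \<omega>) $ j) (if i = j then t - s else 0)"
    "has_bochner_integral M (\<lambda>\<omega>. ((B t \<omega> - B s \<omega>) $ i) ^ 4) (3 * (t - s)\<^sup>2)"
    using normal_vector_moments[OF d s] unfolding p by blast+
qed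

context
  fixes s t :: real and w :: "'w \<Rightarrow> real ^ 'd" and V :: "'w \<Rightarrow> real"
  assumes st: "0 \<le> s" "s < t" "t \<le> T"
    and w: "w \<in> bounded_borel (F s)" and V: "V \<in> bounded_borel (F s)"
begin

text \<open>Testing against every bounded \<open>V\<close> known at time \<open>s\<close> plays the
  role of the conditional expectation given \<open>F s\<close>; here it says that a step of a simple
  integral has mean zero given the past.\<close>

lemma weighted_first_moment:
  "has_bochner_integral M (\<lambda>\<omega>. V \<omega> * (w \<omega> \<bullet> (B t \<omega> - B s \<omega>))) 0"
proof -
  have "has_bochner_integral M (\<lambda>\<omega>. (V \<omega> * w \<omega> $ i) * (B t \<omega> - B s \<omega>) $ i)
      ((\<integral>\<omega>. V \<omega> * w \<omega> $ i \<partial>M) * 0)" for i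
  proof (rule augmented_indep_increment[OF brownian sets_M st, where f="\<lambda>x. x $ i"])
    have *: "(\<lambda>\<omega>. V \<omega> * w \<omega> $ i) \<in> bounded_borel (F s)"
      by (intro bounded_borel_mult V bounded_borel_nth w)
    then show "(\<lambda>\<omega>. V \<omega> * w \<omega> $ i) \<in> borel_measurable (F s)"
      by (auto simp: bounded_borel_def)
    show "integrable M (\<lambda>\<omega>. V \<omega> * w \<omega> $ i)"
      using * st by (intro integrable_bounded_borel[of s]) auto
  qed (use increment_moments(1)[OF st] in auto)
  then have "has_bochner_integral M (\<lambda>\<omega>. \<Sum>i\<in>UNIV. (V \<omega> * w \<omega> $ i) * (B t \<omega> - B s \<omega>) $ i) (\<Sum>i\<in>UNIV. (\<integral>\<omega>. V \<omega> * w \<omega> $ i \<partial>M) * 0)"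
    by (intro has_bochner_integral_sum)
  then show ?thesis
    by (simp add: inner_vec_def sum_distrib_left mult.assoc)
qed

text \<open>The one-step Ito isometry: the coordinates of the increment are uncorrelated with
  variance \<open>t - s\<close>, so only the diagonal terms of the expanded square survive.\<close>

lemma weighted_second_moment:
  "has_bochner_integral M (\<lambda>\<omega>. V \<omega> * (w \<omega> \<bullet> (B t \<omega> - B s \<omega>))\<^sup>2) (\<integral>\<omega>. V \<omega> * ((norm (w \<omega>))\<^sup>2 * (t - s)) \<partial>M)"
proof -
  let ?D = "\<lambda>\<omega>. B t \<omega> - B s \<omega>"
  have b: "(\<lambda>\<omega>. V \<omega> * w \<omega> $ i * w \<omega> $ j) \<in> bounded_borel (F s)" for i j
    by (intro bounded_borel_mult V bounded_borel_nth w)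
  have ib: "integrable M (\<lambda>\<omega>. V \<omega> * w \<omega> $ i * w \<omega> $ j)" for i j
    using b st by (auto intro: integrable_bounded_borel[of s])
  have "has_bochner_integral M (\<lambda>\<omega>. (V \<omega> * w \<omega> $ i * w \<omega> $ j) * (?D \<omega> $ i * ?D \<omega> $ j))
      ((\<integral>\<omega>. V \<omega> * w \<omega> $ i * w \<omega> $ j \<partial>M) * (if i = j then t - s else 0))" for i j
    by (rule augmented_indep_increment[OF brownian sets_M st, where f="\<lambda>x. x $ i * x $ j"])
      (use b ib increment_moments(2)[OF st] in \<open>auto simp: bounded_borel_def\<close>)
  then have "has_bochner_integral M (\<lambda>\<omega>. \<Sum>i\<in>UNIV. \<Sum>j\<in>UNIV. (V \<omega> * w \<omega> $ i * w \<omega> $ j) * (?D \<omega> $ i * ?D \<omega> $ j))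
      (\<Sum>i\<in>UNIV. \<Sum>j\<in>UNIV. (\<integral>\<omega>. V \<omega> * w \<omega> $ i * w \<omega> $ j \<partial>M) * (if i = j then t - s else 0))"
    by (intro has_bochner_integral_sum)
  moreover have "(\<Sum>i\<in>UNIV. \<Sum>j\<in>UNIV. (V \<omega> * w \<omega> $ i * w \<omega> $ j) * (?D \<omega> $ i * ?D \<omega> $ j)) = V \<omega> * (w \<omega> \<bullet> ?D \<omega>)\<^sup>2" for \<omega>
    by (simp add: inner_vec_def power2_eq_square sum_product sum_distrib_left ac_simps)
  moreover have "(\<Sum>i\<in>UNIV. \<Sum>j\<in>UNIV. (\<integral>\<omega>. V \<omega> * w \<omega> $ i * w \<omega> $ j \<partial>M) * (if i = j then t - s else 0))
      = (\<integral>\<omega>. V \<omega> * ((norm (w \<omega>))\<^sup>2 * (t - s)) \<partial>M)"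
  proof -
    have "(\<Sum>i\<in>UNIV. \<Sum>j\<in>UNIV. (\<integral>\<omega>. V \<omega> * w \<omega> $ i * w \<omega> $ j \<partial>M) * (if i = j then t - s else 0))
        = (\<Sum>i\<in>UNIV. \<integral>\<omega>. V \<omega> * w \<omega> $ i * w \<omega> $ i * (t - s) \<partial>M)"
      by (simp add: if_distrib sum.delta cong: if_cong)
    also have "\<dots> = (\<integral>\<omega>. (\<Sum>i\<in>UNIV. V \<omega> * w \<omega> $ i * w \<omega> $ i * (t - s)) \<partial>M)"
      by (rule Bochner_Integration.integral_sum[symmetric]) (use ib in auto)
    also have "\<dots> = (\<integral>\<omega>. V \<omega> * ((norm (w \<omega>))\<^sup>2 * (t - s)) \<partial>M)"
      by (simp add: norm_vec_def L2_set_def sum_nonneg sum_distrib_left sum_distrib_right power2_eq_square ac_simps)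
    finally show ?thesis .
  qed
  ultimately show ?thesis by simp
qed

text \<open>Given the past, the inner product is Gaussian with variance |w|^2 (t - s), so the sharp
  factor is 3. Passing to the norms of both vectors costs the square of the dimension, which only
  affects how finely time is divided later.\<close>

lemma weighted_fourth_moment:
  assumes V0: "\<And>\<omega>. 0 \<le> V \<omega>"
  shows "integrable M (\<lambda>\<omega>. V \<omega> * (w \<omega> \<bullet> (B t \<omega> - B s \<omega>)) ^ 4)"
    and "(\<integral>\<omega>. V \<omega> * (w \<omega> \<bullet> (B t \<omega> - B s \<omega>)) ^ 4 \<partial>M)
           \<le> 3 * (real CARD('d))\<^sup>2 * (\<integral>\<omega>. V \<omega> * ((norm (w \<omega>))\<^sup>2 * (t - s))\<^sup>2 \<partial>M)"
proof -
  let ?D = "\<lambda>\<omega>. B t \<omega> - B s \<omega>"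
  let ?R = "\<lambda>\<omega>. \<Sum>i\<in>UNIV. (CARD('d) * (V \<omega> * norm (w \<omega>) ^ 4)) * (?D \<omega> $ i) ^ 4"
  have b: "(\<lambda>\<omega>. V \<omega> * norm (w \<omega>) ^ 4) \<in> bounded_borel (F s)"
    by (intro bounded_borel_mult V bounded_borel_norm_power w)
  have ib: "integrable M (\<lambda>\<omega>. V \<omega> * norm (w \<omega>) ^ 4)"
    using b st by (auto intro: integrable_bounded_borel[of s])
  have "has_bochner_integral M (\<lambda>\<omega>. (CARD('d) * (V \<omega> * norm (w \<omega>) ^ 4)) * (?D \<omega> $ i) ^ 4)
      ((\<integral>\<omega>. CARD('d) * (V \<omega> * norm (w \<omega>) ^ 4) \<partial>M) * (3 * (t - s)\<^sup>2))" for i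
    by (rule augmented_indep_increment[OF brownian sets_M st, where f="\<lambda>x. (x $ i) ^ 4"])
      (use b ib increment_moments(3)[OF st] in \<open>auto simp: bounded_borel_def\<close>)
  then have R: "has_bochner_integral M ?R (\<Sum>i\<in>(UNIV::'d set). (\<integral>\<omega>. CARD('d) * (V \<omega> * norm (w \<omega>) ^ 4) \<partial>M) * (3 * (t - s)\<^sup>2))"
    by (intro has_bochner_integral_sum)
  have le: "V \<omega> * (w \<omega> \<bullet> ?D \<omega>) ^ 4 \<le> ?R \<omega>" for \<omega>
  proof -
    have "(w \<omega> \<bullet> ?D \<omega>) ^ 4 = \<bar>w \<omega> \<bullet> ?D \<omega>\<bar> ^ 4" by simp
    also have "\<dots> \<le> (norm (w \<omega>) * norm (?D \<omega>)) ^ 4"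
      by (intro power_mono Cauchy_Schwarz_ineq2) auto
    also have "\<dots> \<le> norm (w \<omega>) ^ 4 * (CARD('d) * (\<Sum>i\<in>UNIV. (?D \<omega> $ i) ^ 4))"
      unfolding power_mult_distrib by (intro mult_left_mono norm_pow4_le) auto
    finally have "V \<omega> * (w \<omega> \<bullet> ?D \<omega>) ^ 4 \<le> V \<omega> * (norm (w \<omega>) ^ 4 * (CARD('d) * (\<Sum>i\<in>UNIV. (?D \<omega> $ i) ^ 4)))"
      using V0 by (intro mult_left_mono) auto
    then show ?thesis by (simp add: sum_distrib_left ac_simps)
  qed
  have Bm: "B s \<in> borel_measurable M" "B t \<in> borel_measurable M"
    using brownian st by (auto simp: brownian_motion_def)
  have [measurable]: "V \<in> borel_measurable M" "w \<in> borel_measurable M"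
    using V w st by (auto simp: bounded_borel_def intro: measurable_F[of s])
  show i: "integrable M (\<lambda>\<omega>. V \<omega> * (w \<omega> \<bullet> ?D \<omega>) ^ 4)"
  proof (rule Bochner_Integration.integrable_bound)
    show "integrable M ?R" using R by (rule integrable.intros)
    show "(\<lambda>\<omega>. V \<omega> * (w \<omega> \<bullet> ?D \<omega>) ^ 4) \<in> borel_measurable M" using Bm by measurable
    show "AE \<omega> in M. norm (V \<omega> * (w \<omega> \<bullet> ?D \<omega>) ^ 4) \<le> norm (?R \<omega>)"
    proof (rule AE_I2)
      fix \<omega>
      have "0 \<le> V \<omega> * (w \<omega> \<bullet> ?D \<omega>) ^ 4" using V0 by simp
      then show "norm (V \<omega> * (w \<omega> \<bullet> ?D \<omega>) ^ 4) \<le> norm (?R \<omega>)"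
        using le[of \<omega>] unfolding real_norm_def by linarith
    qed
  qed
  have "(\<integral>\<omega>. V \<omega> * (w \<omega> \<bullet> ?D \<omega>) ^ 4 \<partial>M) \<le> (\<integral>\<omega>. ?R \<omega> \<partial>M)"
    using i R le by (intro integral_mono) (auto intro: integrable.intros)
  also have "\<dots> = CARD('d) * (CARD('d) * (\<integral>\<omega>. (V \<omega> * norm (w \<omega>) ^ 4) \<partial>M) * (3 * (t - s)\<^sup>2))"
    using has_bochner_integral_integral_eq[OF R] by simp
  also have "\<dots> = 3 * (real CARD('d))\<^sup>2 * ((\<integral>\<omega>. (V \<omega> * norm (w \<omega>) ^ 4) \<partial>M) * (t - s)\<^sup>2)"
    by (simp add: power2_eq_square ac_simps)
  also have "(\<integral>\<omega>. (V \<omega> * norm (w \<omega>) ^ 4) \<partial>M) * (t - s)\<^sup>2 = (\<integral>\<omega>. V \<omega> * norm (w \<omega>) ^ 4 * (t - s)\<^sup>2 \<partial>M)"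
    by simp
  also have "(\<lambda>\<omega>. V \<omega> * norm (w \<omega>) ^ 4 * (t - s)\<^sup>2) = (\<lambda>\<omega>. V \<omega> * ((norm (w \<omega>))\<^sup>2 * (t - s))\<^sup>2)"
    by (simp add: power_mult_distrib mult.assoc flip: power_mult)
  finally show "(\<integral>\<omega>. V \<omega> * (w \<omega> \<bullet> ?D \<omega>) ^ 4 \<partial>M)
           \<le> 3 * (real CARD('d))\<^sup>2 * (\<integral>\<omega>. V \<omega> * ((norm (w \<omega>))\<^sup>2 * (t - s))\<^sup>2 \<partial>M)" .
qed

end

end

section \<open>Exit supermartingale\<close>

text \<open>The quartic term pays for the overshoot: if \<open>|u + g| > 2 d\<close>, then \<open>|g| \<ge> d\<close> and
  \<open>|u + g| \<le> 2 |g|\<close>.\<close>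

lemma quadratic_exit_bound:
  fixes u g d :: real
  assumes "\<bar>u\<bar> \<le> d" "0 < d"
  shows "(if \<bar>u + g\<bar> \<le> d then 1 else 0) * (4 * d\<^sup>2 - (u + g)\<^sup>2)
       \<le> (4 * d\<^sup>2 - u\<^sup>2) - 2 * u * g - g\<^sup>2 + 4 / d\<^sup>2 * g ^ 4"
proof -
  have eq: "(4 * d\<^sup>2 - u\<^sup>2) - 2 * u * g - g\<^sup>2 + 4 / d\<^sup>2 * g ^ 4 = 4 * d\<^sup>2 - (u + g)\<^sup>2 + 4 / d\<^sup>2 * g ^ 4"
    by (simp add: power2_sum)
  have nn: "0 \<le> 4 / d\<^sup>2 * g ^ 4" by simp
  have "0 \<le> 4 * d\<^sup>2 - (u + g)\<^sup>2 + 4 / d\<^sup>2 * g ^ 4"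
  proof (cases "\<bar>u + g\<bar> \<le> 2 * d")
    case True
    then have "(u + g)\<^sup>2 \<le> (2 * d)\<^sup>2" by (rule power2_le_iff_abs_le[THEN iffD2, rotated]) (use assms in simp)
    then have "(u + g)\<^sup>2 \<le> 4 * d\<^sup>2" by (simp add: power_mult_distrib)
    then show ?thesis using nn by linarith
  next
    case False
    then have g: "\<bar>u + g\<bar> \<le> 2 * \<bar>g\<bar>" "d \<le> \<bar>g\<bar>"
      using assms by linarith+
    have "(u + g)\<^sup>2 \<le> (2 * \<bar>g\<bar>)\<^sup>2"
      using power_mono[OF g(1) abs_ge_zero, of 2] by simp
    also have "\<dots> = 4 * g\<^sup>2" by (simp add: power_mult_distrib)
    also have "\<dots> \<le> 4 * (g\<^sup>2 * (g\<^sup>2 / d\<^sup>2))"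
    proof -
      have "d\<^sup>2 \<le> g\<^sup>2" using g(2) assms by (metis abs_le_square_iff abs_of_pos)
      then have "1 \<le> g\<^sup>2 / d\<^sup>2" using assms by simp
      then show ?thesis using mult_left_mono[of 1 "g\<^sup>2 / d\<^sup>2" "g\<^sup>2"] by simp
    qed
    also have "\<dots> = 4 / d\<^sup>2 * g ^ 4" by (simp add: power4_eq_xxxx power2_eq_square)
    finally show ?thesis using zero_le_power2[of d] by linarith
  qed
  then show ?thesis unfolding eq using nn by auto
qed

text \<open>\<open>a\<close> is the quadratic variation of one step and \<open>K * a\<^sup>2\<close>
  a bound on its fourth moment. The condition a \<le> d^2 / (8 K) makes the overshoot term at most
  a/2. Since 4 d^2 - u^2 \<le> 4 d^2, the remaining drift - a/2 shrinks 4 d^2 - u^2 at least by the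
  factor 1 - x \<le> exp (- x) with x = a / (8 d^2).\<close>

lemma exp_drift_bound:
  fixes a d u :: real
  assumes "0 \<le> a" "0 < d" "0 < K" "a \<le> d\<^sup>2 / (8 * K)" "\<bar>u\<bar> \<le> d"
  shows "exp (a / (8 * d\<^sup>2)) * ((4 * d\<^sup>2 - u\<^sup>2) - a + 4 / d\<^sup>2 * (K * a\<^sup>2)) \<le> 4 * d\<^sup>2 - u\<^sup>2"
proof -
  have u: "u\<^sup>2 \<le> d\<^sup>2" using assms by (simp add: abs_le_square_iff[symmetric])
  have q: "0 \<le> 4 * d\<^sup>2 - u\<^sup>2" "4 * d\<^sup>2 - u\<^sup>2 \<le> 4 * d\<^sup>2"
    using u zero_le_power2[of u] by (auto intro: order_trans[of _ "d\<^sup>2"])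
  have "4 / d\<^sup>2 * (K * a\<^sup>2) = (4 * K * a / d\<^sup>2) * a" by (simp add: power2_eq_square)
  also have "\<dots> \<le> (1 / 2) * a"
    using assms by (intro mult_right_mono) (auto simp: field_simps)
  finally have "(4 * d\<^sup>2 - u\<^sup>2) - a + 4 / d\<^sup>2 * (K * a\<^sup>2) \<le> (4 * d\<^sup>2 - u\<^sup>2) - a / 2" by linarith
  also have "a / (8 * d\<^sup>2) * (4 * d\<^sup>2 - u\<^sup>2) \<le> a / (8 * d\<^sup>2) * (4 * d\<^sup>2)"
    using assms q by (intro mult_left_mono) auto
  then have "(4 * d\<^sup>2 - u\<^sup>2) - a / 2 \<le> (4 * d\<^sup>2 - u\<^sup>2) * (1 - a / (8 * d\<^sup>2))"
    using assms by (simp add: field_simps)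
  also have "\<dots> \<le> (4 * d\<^sup>2 - u\<^sup>2) * exp (- (a / (8 * d\<^sup>2)))"
    using exp_ge_add_one_self[of "- (a / (8 * d\<^sup>2))"] q by (intro mult_left_mono) auto
  finally have "exp (a / (8 * d\<^sup>2)) * ((4 * d\<^sup>2 - u\<^sup>2) - a + 4 / d\<^sup>2 * (K * a\<^sup>2))
      \<le> exp (a / (8 * d\<^sup>2)) * ((4 * d\<^sup>2 - u\<^sup>2) * exp (- (a / (8 * d\<^sup>2))))"
    by (rule mult_left_mono) simp
  also have "\<dots> = 4 * d\<^sup>2 - u\<^sup>2" by (simp add: exp_minus)
  finally show ?thesis .
qed

text \<open>\<open>W\<close> vanishes wherever |U| > d, so the unbounded square of \<open>U\<close>
  does no harm.\<close>

lemma bounded_borel_quadratic: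
  fixes U W :: "'w \<Rightarrow> real"
  assumes W: "W \<in> bounded_borel F" and U: "U \<in> borel_measurable F"
    and WU: "\<And>\<omega>. W \<omega> \<noteq> 0 \<Longrightarrow> \<bar>U \<omega>\<bar> \<le> d"
  shows "(\<lambda>\<omega>. W \<omega> * (4 * d\<^sup>2 - (U \<omega>)\<^sup>2)) \<in> bounded_borel F"
proof -
  obtain C where C: "W \<in> borel_measurable F" "0 \<le> C" "\<And>\<omega>. \<omega> \<in> space F \<Longrightarrow> norm (W \<omega>) \<le> C"
    using W by (rule bounded_borelE) blast
  show ?thesis
  proof (rule bounded_borelI)
    show "(\<lambda>\<omega>. W \<omega> * (4 * d\<^sup>2 - (U \<omega>)\<^sup>2)) \<in> borel_measurable F"
      using C(1) U by measurable
    fix \<omega> assume \<omega>: "\<omega> \<in> space F"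
    show "norm (W \<omega> * (4 * d\<^sup>2 - (U \<omega>)\<^sup>2)) \<le> C * (4 * d\<^sup>2)"
    proof (cases "W \<omega> = 0")
      case False
      then have "(U \<omega>)\<^sup>2 \<le> d\<^sup>2" using power_mono[OF WU[OF False] abs_ge_zero, of 2] by simp
      then have "\<bar>4 * d\<^sup>2 - (U \<omega>)\<^sup>2\<bar> \<le> 4 * d\<^sup>2"
        using zero_le_power2[of "U \<omega>"] zero_le_power2[of d] by linarith
      then show ?thesis using C(2) C(3)[OF \<omega>]
        unfolding norm_mult by (intro mult_mono) auto
    qed (use C(2) in simp)
  qed
qed

context brownian
begin

text \<open>In the application \<open>W\<close> is the product of the exponentials so far, set to 0
  once |U| has exceeded \<open>d\<close> at the end of a step. \<open>quadratic_exit_bound\<close>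
  is integrated against the past: its linear term vanishes, its quadratic term gives a = |w|^2 (t -
  s) and its quartic term at most K a^2. By \<open>exp_drift_bound\<close> the resulting loss
  outweighs the new exponential factor.\<close>

lemma exit_supermartingale_step:
  fixes U W :: "'w \<Rightarrow> real" and w :: "'w \<Rightarrow> real ^ 'd"
  assumes st: "0 \<le> s" "s < t" "t \<le> T" and d: "0 < d"
    and w: "w \<in> bounded_borel (F s)" and W: "W \<in> bounded_borel (F s)"
    and U: "U \<in> borel_measurable (F s)"
    and W0: "\<And>\<omega>. 0 \<le> W \<omega>" and WU: "\<And>\<omega>. W \<omega> \<noteq> 0 \<Longrightarrow> \<bar>U \<omega>\<bar> \<le> d"
    and small: "\<And>\<omega>. (norm (w \<omega>))\<^sup>2 * (t - s) \<le> d\<^sup>2 / (24 * (real CARD('d))\<^sup>2)"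
  defines "U' \<equiv> \<lambda>\<omega>. U \<omega> + w \<omega> \<bullet> (B t \<omega> - B s \<omega>)"
  defines "W' \<equiv> \<lambda>\<omega>. W \<omega> * exp ((norm (w \<omega>))\<^sup>2 * (t - s) / (8 * d\<^sup>2)) * (if \<bar>U' \<omega>\<bar> \<le> d then 1 else 0)"
  shows "U' \<in> borel_measurable (F t)" and "W' \<in> bounded_borel (F t)"
    and "(\<integral>\<omega>. W' \<omega> * (4 * d\<^sup>2 - (U' \<omega>)\<^sup>2) \<partial>M) \<le> (\<integral>\<omega>. W \<omega> * (4 * d\<^sup>2 - (U \<omega>)\<^sup>2) \<partial>M)"
proof -
  let ?D = "\<lambda>\<omega>. B t \<omega> - B s \<omega>" and ?a = "\<lambda>\<omega>. (norm (w \<omega>))\<^sup>2 * (t - s)"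
  define g where "g \<omega> = w \<omega> \<bullet> ?D \<omega>" for \<omega>
  \<comment> \<open>With this \<open>K\<close> the hypothesis \<open>small\<close> is the bound d^2
    / (8 K) that \<open>exp_drift_bound\<close> asks for.\<close>
  define K where "K = 3 * (real CARD('d))\<^sup>2"
  have K: "0 < K" by (simp add: K_def)
  \<comment> \<open>The new exponential factor depends only on the integrand and is known at time
    \<open>s\<close>; in \<open>W'\<close> only the killing indicator involves the new
    increment.\<close>
  define V where "V \<omega> = W \<omega> * exp (?a \<omega> / (8 * d\<^sup>2))" for \<omega>
  have a0: "0 \<le> ?a \<omega>" and aK: "?a \<omega> \<le> d\<^sup>2 / (8 * K)" for \<omega>
    using st small[of \<omega>] by (auto simp: K_def)
  have Ws: "W \<in> borel_measurable (F s)" and ws: "w \<in> borel_measurable (F s)"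
    using W w by (auto simp: bounded_borel_def)
  have "(\<lambda>\<omega>. exp (?a \<omega> / (8 * d\<^sup>2))) \<in> bounded_borel (F s)"
  proof (rule bounded_borelI)
    show "(\<lambda>\<omega>. exp (?a \<omega> / (8 * d\<^sup>2))) \<in> borel_measurable (F s)" using ws by measurable
    show "norm (exp (?a \<omega> / (8 * d\<^sup>2))) \<le> exp (d\<^sup>2 / (8 * K) / (8 * d\<^sup>2))" for \<omega>
      using divide_right_mono[OF aK[of \<omega>], of "8 * d\<^sup>2"] by simp
  qed
  then have V: "V \<in> bounded_borel (F s)"
    unfolding V_def by (intro bounded_borel_mult W)
  have Vs: "V \<in> borel_measurable (F s)" using V by (auto simp: bounded_borel_def)
  have V0: "0 \<le> V \<omega>" and VU: "V \<omega> \<noteq> 0 \<Longrightarrow> \<bar>U \<omega>\<bar> \<le> d" for \<omega>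
    using W0[of \<omega>] WU[of \<omega>] by (auto simp: V_def)
  have Bt: "B s \<in> borel_measurable (F t)" "B t \<in> borel_measurable (F t)"
    using st by (auto intro!: brownian_adapted)
  have t: "U \<in> borel_measurable (F t)" "w \<in> borel_measurable (F t)" "V \<in> borel_measurable (F t)"
    using U ws Vs st by (auto intro: borel_measurable_augmented_mono[of s t])
  show U't: "U' \<in> borel_measurable (F t)"
    unfolding U'_def using Bt t by measurable
  have W'V: "W' \<omega> = V \<omega> * (if \<bar>U' \<omega>\<bar> \<le> d then 1 else 0)" for \<omega>
    by (simp add: W'_def V_def)
  obtain C where C: "\<And>\<omega>. \<omega> \<in> space (F s) \<Longrightarrow> norm (V \<omega>) \<le> C" using V by (rule bounded_borelE) blast
  show W': "W' \<in> bounded_borel (F t)"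
  proof (rule bounded_borelI)
    have [measurable]: "Measurable.pred (F t) (\<lambda>\<omega>. \<bar>U' \<omega>\<bar> \<le> d)" using U't by measurable
    show "W' \<in> borel_measurable (F t)" unfolding W'V using t U't by measurable
    show "\<omega> \<in> space (F t) \<Longrightarrow> norm (W' \<omega>) \<le> C" for \<omega>
      using C[of \<omega>] V0[of \<omega>] by (auto simp: W'V)
  qed
  have VUk: "(\<lambda>\<omega>. V \<omega> * U \<omega> ^ k) \<in> bounded_borel (F s)" for k
  proof (rule bounded_borelI)
    show "(\<lambda>\<omega>. V \<omega> * U \<omega> ^ k) \<in> borel_measurable (F s)" using Vs U by measurable
    show "norm (V \<omega> * U \<omega> ^ k) \<le> C * d ^ k" if "\<omega> \<in> space (F s)" for \<omega>
    proof (cases "V \<omega> = 0")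
      case True
      then show ?thesis using order_trans[OF norm_ge_zero C[OF that]] d by simp
    next
      case False
      then show ?thesis using VU[OF False] C[OF that] V0[of \<omega>]
        by (auto simp: abs_mult power_abs intro!: mult_mono power_mono)
    qed
  qed
  have Vq: "(\<lambda>\<omega>. V \<omega> * (?a \<omega>) ^ k) \<in> bounded_borel (F s)" for k
  proof (rule bounded_borelI)
    show "(\<lambda>\<omega>. V \<omega> * (?a \<omega>) ^ k) \<in> borel_measurable (F s)" using Vs ws by measurable
    show "norm (V \<omega> * (?a \<omega>) ^ k) \<le> C * (d\<^sup>2 / (8 * K)) ^ k" if "\<omega> \<in> space (F s)" for \<omega>
      using C[OF that] V0[of \<omega>] power_mono[OF aK a0, of \<omega> k] a0[of \<omega>]
      unfolding norm_mult by (intro mult_mono) auto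
  qed
  have int: "integrable M (\<lambda>\<omega>. V \<omega> * U \<omega> ^ k)" "integrable M (\<lambda>\<omega>. V \<omega> * (?a \<omega>) ^ k)" for k
    using VUk Vq st by (auto intro: integrable_bounded_borel[of s])
  let ?I = "\<lambda>\<omega>. V \<omega> * (4 * d\<^sup>2 - (U \<omega>)\<^sup>2)"
  have I: "integrable M ?I"
    using int(1)[of 0] int(1)[of 2] by (simp add: right_diff_distrib)
  \<comment> \<open>With \<open>V * U\<close> as the weight, the cross term of the square becomes a
    first moment.\<close>
  note m1 = weighted_first_moment[OF st w VUk[of 1], folded g_def]
  note m2 = weighted_second_moment[OF st w V, folded g_def]
  note m4 = weighted_fourth_moment[OF st w V V0, folded g_def K_def]
  let ?R = "\<lambda>\<omega>. ?I \<omega> - 2 * (V \<omega> * U \<omega> ^ 1 * g \<omega>) - V \<omega> * (g \<omega>)\<^sup>2 + 4 / d\<^sup>2 * (V \<omega> * g \<omega> ^ 4)"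
  have iR: "integrable M ?R"
    using I m1 m2 m4 by (intro Bochner_Integration.integrable_add Bochner_Integration.integrable_diff
      integrable_mult_right) (auto simp: has_bochner_integral_iff)
  have "(\<integral>\<omega>. W' \<omega> * (4 * d\<^sup>2 - (U' \<omega>)\<^sup>2) \<partial>M) \<le> (\<integral>\<omega>. ?R \<omega> \<partial>M)"
  proof (rule integral_mono)
    have "(\<lambda>\<omega>. W' \<omega> * (4 * d\<^sup>2 - (U' \<omega>)\<^sup>2)) \<in> bounded_borel (F t)"
      by (rule bounded_borel_quadratic[OF W' U't]) (simp add: W'V split: if_splits)
    then show "integrable M (\<lambda>\<omega>. W' \<omega> * (4 * d\<^sup>2 - (U' \<omega>)\<^sup>2))"
      using st by (intro integrable_bounded_borel[of t])
    show "integrable M ?R" by (rule iR)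
    fix \<omega>
    show "W' \<omega> * (4 * d\<^sup>2 - (U' \<omega>)\<^sup>2) \<le> ?R \<omega>"
    proof (cases "V \<omega> = 0")
      case True
      then show ?thesis by (simp add: W'V)
    next
      case False
      have "V \<omega> * ((if \<bar>U \<omega> + g \<omega>\<bar> \<le> d then 1 else 0) * (4 * d\<^sup>2 - (U \<omega> + g \<omega>)\<^sup>2))
          \<le> V \<omega> * ((4 * d\<^sup>2 - (U \<omega>)\<^sup>2) - 2 * U \<omega> * g \<omega> - (g \<omega>)\<^sup>2 + 4 / d\<^sup>2 * g \<omega> ^ 4)"
        by (intro mult_left_mono quadratic_exit_bound VU False d V0)
      then show ?thesis
        by (simp add: W'V U'_def g_def algebra_simps)
    qed
  qed
  also have "(\<integral>\<omega>. ?R \<omega> \<partial>M) = (\<integral>\<omega>. ?I \<omega> \<partial>M) - 2 * 0 - (\<integral>\<omega>. V \<omega> * ?a \<omega> \<partial>M) + 4 / d\<^sup>2 * (\<integral>\<omega>. V \<omega> * g \<omega> ^ 4 \<partial>M)"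
    using I m1 m2 m4(1) by (simp add: has_bochner_integral_iff)
  also have "\<dots> \<le> (\<integral>\<omega>. ?I \<omega> \<partial>M) - (\<integral>\<omega>. V \<omega> * ?a \<omega> \<partial>M) + 4 / d\<^sup>2 * (K * (\<integral>\<omega>. V \<omega> * (?a \<omega>)\<^sup>2 \<partial>M))"
    using m4(2) by (auto intro!: divide_right_mono)
  also have "\<dots> = (\<integral>\<omega>. ?I \<omega> - V \<omega> * ?a \<omega> + 4 / d\<^sup>2 * (K * (V \<omega> * (?a \<omega>)\<^sup>2)) \<partial>M)"
    using I int(2)[of 1] int(2)[of 2] by simp
  also have "\<dots> \<le> (\<integral>\<omega>. W \<omega> * (4 * d\<^sup>2 - (U \<omega>)\<^sup>2) \<partial>M)"
  proof (rule integral_mono)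
    show "integrable M (\<lambda>\<omega>. ?I \<omega> - V \<omega> * ?a \<omega> + 4 / d\<^sup>2 * (K * (V \<omega> * (?a \<omega>)\<^sup>2)))"
      using I int(2)[of 1] int(2)[of 2] by simp
    show "integrable M (\<lambda>\<omega>. W \<omega> * (4 * d\<^sup>2 - (U \<omega>)\<^sup>2))"
      using integrable_bounded_borel[OF _ bounded_borel_quadratic[OF W U WU]] st by simp
    fix \<omega>
    show "?I \<omega> - V \<omega> * ?a \<omega> + 4 / d\<^sup>2 * (K * (V \<omega> * (?a \<omega>)\<^sup>2)) \<le> W \<omega> * (4 * d\<^sup>2 - (U \<omega>)\<^sup>2)"
    proof (cases "W \<omega> = 0")
      case True
      then show ?thesis by (simp add: V_def)
    next
      case False
      have "W \<omega> * (exp (?a \<omega> / (8 * d\<^sup>2)) * ((4 * d\<^sup>2 - (U \<omega>)\<^sup>2) - ?a \<omega> + 4 / d\<^sup>2 * (K * (?a \<omega>)\<^sup>2))) \<le> W \<omega> * (4 * d\<^sup>2 - (U \<omega>)\<^sup>2)"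
        by (intro mult_left_mono exp_drift_bound a0 d K aK WU False W0)
      then show ?thesis by (simp add: V_def algebra_simps)
    qed
  qed
  finally show "(\<integral>\<omega>. W' \<omega> * (4 * d\<^sup>2 - (U' \<omega>)\<^sup>2) \<partial>M) \<le> (\<integral>\<omega>. W \<omega> * (4 * d\<^sup>2 - (U \<omega>)\<^sup>2) \<partial>M)" .
qed

end

section \<open>Cells of a simple integrand\<close>

lemma cell_exists:
  fixes p :: "nat \<Rightarrow> real"
  assumes "p 0 \<le> a" "b \<le> p m" "a < b" "\<And>k. k \<le> m \<Longrightarrow> \<not> (a < p k \<and> p k < b)"
  shows "\<exists>k<m. p k \<le> a \<and> b \<le> p (Suc k)"
  using assms
proof (induction m)
  case (Suc m)
  show ?case
  proof (cases "p m \<le> a")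
    case True
    then show ?thesis using Suc.prems by blast
  next
    case False
    then have "b \<le> p m" using Suc.prems(4)[of m] by auto
    then show ?thesis using Suc by (metis le_SucI less_SucI)
  qed
qed simp

text \<open>\<open>exit_supermartingale_step\<close> will be applied to short intervals inside one
  cell of the integrand. Being joined by a chain of such intervals passes from local to global by
  bisection (\<open>Bolzano\<close>), and the chain supports induction, so no refined partition has
  to be enumerated.\<close>

lemma refinement_chain:
  fixes p :: "nat \<Rightarrow> real"
  assumes "p 0 \<le> s" "s \<le> t" "t \<le> p m" "0 < e"
  shows "(\<lambda>a b. a < b \<and> b - a \<le> e \<and> (\<exists>k<m. p k \<le> a \<and> b \<le> p (Suc k)))\<^sup>*\<^sup>* s t" (is "?R\<^sup>*\<^sup>* s t")
proof -
  have "p 0 \<le> s \<and> t \<le> p m \<longrightarrow> ?R\<^sup>*\<^sup>* s t"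
    using \<open>s \<le> t\<close>
  proof (induction rule: Bolzano)
    case (trans a b c)
    then show ?case by (meson order_trans rtranclp_trans)
  next
    case (local x)
    \<comment> \<open>Within distance \<open>d\<close> of \<open>x\<close> the only possible
      partition point is \<open>x\<close> itself, so a short interval around \<open>x\<close> has to
      be cut only there.\<close>
    obtain d where d: "0 < d" "\<And>y. y \<in> p ` {..m} \<Longrightarrow> y \<noteq> x \<Longrightarrow> d \<le> dist x y"
      using finite_set_avoid[of "p ` {..m}" x] by blast
    have avoid: "\<not> (a < p k \<and> p k < b)" if "k \<le> m" "(x - d < a \<and> b \<le> x) \<or> (x \<le> a \<and> b < x + d)" for a b k
      using d(2)[of "p k"] that by (auto simp: dist_real_def)
    have "p 0 \<le> a \<and> b \<le> p m \<longrightarrow> ?R\<^sup>*\<^sup>* a b" if *: "a \<le> x" "x \<le> b" "b - a < min d e" for a b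
    proof
      assume "p 0 \<le> a \<and> b \<le> p m"
      then have "?R\<^sup>*\<^sup>* a x"
        using * avoid[of _ a x] cell_exists[of p a x m] by (cases "a = x") (auto intro!: r_into_rtranclp)
      moreover have "?R\<^sup>*\<^sup>* x b"
        using * avoid[of _ x b] cell_exists[of p x b m] \<open>p 0 \<le> a \<and> b \<le> p m\<close>
        by (cases "x = b") (auto intro!: r_into_rtranclp)
      ultimately show "?R\<^sup>*\<^sup>* a b" by (rule rtranclp_trans)
    qed
    then show ?case using d(1) \<open>0 < e\<close> by (intro exI[of _ "min d e"]) auto
  qed
  with assms show ?thesis by simp
qed

lemma simple_data_mono:
  assumes "simple_data F T m p \<xi>" "k \<le> l" "l \<le> m"
  shows "p k \<le> p l"
  using assms(2,3)
proof (induction l rule: dec_induct)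
  case (step n)
  then have "p n \<le> p (Suc n)" using assms(1) by (auto simp: simple_data_def)
  then show ?case using step by simp
qed simp

text \<open>Summands of earlier cells are frozen at the same value at \<open>a\<close> and
  \<open>b\<close>, those of later cells are 0 at both; only cell \<open>k\<close>
  contributes.\<close>

lemma simple_integral_cell:
  assumes sd: "simple_data F T m p \<xi>" and k: "k < m" "p k \<le> a" "a \<le> b" "b \<le> p (Suc k)"
  shows "simple_integral B m p \<xi> b \<omega> - simple_integral B m p \<xi> a \<omega> = \<xi> k \<omega> *v (B b \<omega> - B a \<omega>)"
proof -
  have *: "\<xi> j \<omega> *v (B (min b (p (Suc j))) \<omega> - B (min b (p j)) \<omega>)
         - \<xi> j \<omega> *v (B (min a (p (Suc j))) \<omega> - B (min a (p j)) \<omega>)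
       = (if j = k then \<xi> k \<omega> *v (B b \<omega> - B a \<omega>) else 0)" if "j < m" for j
  proof -
    consider "j < k" | "j = k" | "k < j" by linarith
    then show ?thesis
    proof cases
      case 1
      then have "p (Suc j) \<le> p k" "p j \<le> p k" using k that by (auto intro!: simple_data_mono[OF sd])
      then show ?thesis using 1 k by (simp add: min_absorb2)
    next
      case 2
      have "min b (p (Suc k)) = b" "min b (p k) = p k" "min a (p (Suc k)) = a" "min a (p k) = p k"
        using k by auto
      then show ?thesis using 2 by (simp add: matrix_vector_mult_diff_distrib)
    next
      case 3
      then have "p (Suc k) \<le> p j" "p (Suc k) \<le> p (Suc j)" using k that by (auto intro!: simple_data_mono[OF sd])
      then show ?thesis using 3 k by (simp add: min_absorb1)
    qed
  qed
  have "simple_integral B m p \<xi> b \<omega> - simple_integral B m p \<xi> a \<omega>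
      = (\<Sum>j<m. if j = k then \<xi> k \<omega> *v (B b \<omega> - B a \<omega>) else 0)"
    unfolding simple_integral_def sum_subtractf[symmetric]
    by (intro sum.cong refl *) simp
  then show ?thesis using k(1) by simp
qed

lemma simple_process_cell:
  assumes sd: "simple_data F T m p \<xi>" and k: "k < m" "p k < r" "r \<le> p (Suc k)"
  shows "simple_process m p \<xi> r \<omega> = \<xi> k \<omega>"
proof -
  have "indicator {p j<..p (Suc j)} r *\<^sub>R \<xi> j \<omega> = (if j = k then \<xi> k \<omega> else 0)" if "j < m" for j
  proof -
    consider "j < k" | "j = k" | "k < j" by linarith
    then show ?thesis
    proof cases
      case 1
      then have "p (Suc j) \<le> p k" using k that by (auto intro!: simple_data_mono[OF sd])
      then show ?thesis using 1 k by auto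
    next
      case 3
      then have "p (Suc k) \<le> p j" using k that by (auto intro!: simple_data_mono[OF sd])
      then show ?thesis using 3 k by auto
    qed (use k in auto)
  qed
  then have "simple_process m p \<xi> r \<omega> = (\<Sum>j<m. if j = k then \<xi> k \<omega> else 0)"
    unfolding simple_process_def by (intro sum.cong) auto
  then show ?thesis using k(1) by simp
qed

lemma borel_measurable_simple_process [measurable]:
  "(\<lambda>r. simple_process m p \<xi> r \<omega>) \<in> borel_measurable borel"
  unfolding simple_process_def by measurable

context brownian
begin

text \<open>The event that \<open>Y\<close> stays in \<open>[-d, d]\<close> need not be measurable; the measurable weight \<open>W\<close>
  dominates \<open>exp (A / (8 d\<^sup>2))\<close> on it.\<close>

lemma simple_integral_exit_supermartingale:
  fixes i :: 'd
  assumes sd: "simple_data F T m p \<xi>" and st: "0 \<le> s" "s \<le> t" "t \<le> T" and d: "0 < d"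
  defines "Y \<equiv> \<lambda>q \<omega>. simple_integral B m p \<xi> q \<omega> $ i - simple_integral B m p \<xi> s \<omega> $ i"
  shows "\<exists>W U A. W \<in> bounded_borel (F t) \<and> U \<in> borel_measurable (F t) \<and>
    (\<forall>\<omega>. 0 \<le> W \<omega> \<and> (W \<omega> \<noteq> 0 \<longrightarrow> \<bar>U \<omega>\<bar> \<le> d) \<and> U \<omega> = Y t \<omega> \<and> 0 \<le> A \<omega> \<and>
      (\<integral>\<^sup>+r\<in>{s<..t}. ennreal ((norm (simple_process m p \<xi> r \<omega> $ i))\<^sup>2) \<partial>lborel) \<le> ennreal (A \<omega>) \<and>
      ((\<forall>q\<in>{s..t}. \<bar>Y q \<omega>\<bar> \<le> d) \<longrightarrow> exp (A \<omega> / (8 * d\<^sup>2)) \<le> W \<omega>)) \<and>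
    (\<integral>\<omega>. W \<omega> * (4 * d\<^sup>2 - (U \<omega>)\<^sup>2) \<partial>M) \<le> 4 * d\<^sup>2" (is "\<exists>W U A. ?Inv t W U A")
proof -
  have "\<exists>C. \<forall>\<omega>. norm (\<xi> k \<omega>) \<le> C" if "k < m" for k
    using sd that by (auto simp: simple_data_def)
  then obtain c where c: "\<And>k \<omega>. k < m \<Longrightarrow> norm (\<xi> k \<omega>) \<le> c k" by metis
  define C where "C = (\<Sum>k<m. \<bar>c k\<bar>)"
  have C: "norm (\<xi> k \<omega>) \<le> C" if "k < m" for k \<omega>
    using c[OF that, of \<omega>] member_le_sum[of k "{..<m}" "\<lambda>k. \<bar>c k\<bar>"] that unfolding C_def by force
  have C0: "0 \<le> C" by (simp add: C_def sum_nonneg)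
  \<comment> \<open>Steps of length at most \<open>e\<close> are small in the sense of
    \<open>exit_supermartingale_step\<close> for all values of norm at most \<open>C\<close>; adding
    1 avoids a division by 0.\<close>
  define e where "e = d\<^sup>2 / (24 * (real CARD('d))\<^sup>2) / (C\<^sup>2 + 1)"
  have e: "0 < e" using d by (simp add: e_def add_nonneg_pos)
  have Ce: "C\<^sup>2 * e \<le> d\<^sup>2 / (24 * (real CARD('d))\<^sup>2)"
  proof -
    have "C\<^sup>2 * e \<le> (C\<^sup>2 + 1) * e" using e by (intro mult_right_mono) auto
    also have "\<dots> = d\<^sup>2 / (24 * (real CARD('d))\<^sup>2)"
      unfolding e_def using zero_le_power2[of C] by (simp add: add_nonneg_eq_0_iff)
    finally show ?thesis .
  qed
  let ?R = "\<lambda>a b. a < b \<and> b - a \<le> e \<and> (\<exists>k<m. p k \<le> a \<and> b \<le> p (Suc k))"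
  have p: "p 0 = 0" "p m = T" using sd by (auto simp: simple_data_def)
  have "?R\<^sup>*\<^sup>* s t" using refinement_chain[of p s t m e] st e p by simp
  then have "s \<le> t \<and> t \<le> T \<and> (\<exists>W U A. ?Inv t W U A)"
  proof (induction rule: rtranclp_induct)
    case base
    \<comment> \<open>The chain starts with weight 1 at distance 0, where the expectation equals 4
      d^2, the constant of the invariant.\<close>
    have "?Inv s (\<lambda>_. 1) (\<lambda>_. 0) (\<lambda>_. 0)"
      using d by (auto simp: Y_def prob_space intro: bounded_borelI[of _ _ 1])
    then have ex: "\<exists>W U A. ?Inv s W U A" by (intro exI)
    have "s \<le> s" "s \<le> T" using st by auto
    with ex show ?case by (intro conjI)
  next
    case (step u v)
    from step.IH obtain W U A where I: "?Inv u W U A" and u: "s \<le> u" "u \<le> T" by blast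
    from step.hyps(2) obtain k where uv: "u < v" "v - u \<le> e" and k: "k < m" "p k \<le> u" "v \<le> p (Suc k)"
      by blast
    have vT: "v \<le> T" using k simple_data_mono[OF sd, of "Suc k" m] p by simp
    have u0: "0 \<le> u" using u st by simp
    \<comment> \<open>The \<open>i\<close>-th row of the integrand drives the \<open>i\<close>-th
      coordinate of the integral.\<close>
    define w where "w \<omega> = \<xi> k \<omega> $ i" for \<omega>
    have wC: "norm (w \<omega>) \<le> C" for \<omega>
      using C[OF k(1), of \<omega>] Finite_Cartesian_Product.norm_nth_le[of "\<xi> k \<omega>" i] by (simp add: w_def)
    have "\<xi> k \<in> bounded_borel (F (p k))"
      using sd k C[OF k(1)] by (intro bounded_borelI) (auto simp: simple_data_def)
    then have w: "w \<in> bounded_borel (F u)"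
      unfolding w_def by (intro bounded_borel_nth bounded_borel_F_mono[OF k(2)])
    have small: "(norm (w \<omega>))\<^sup>2 * (v - u) \<le> d\<^sup>2 / (24 * (real CARD('d))\<^sup>2)" for \<omega>
    proof -
      have "(norm (w \<omega>))\<^sup>2 * (v - u) \<le> C\<^sup>2 * e"
        using wC uv by (intro mult_mono power_mono) auto
      then show ?thesis using Ce by simp
    qed
    define a where "a \<omega> = (norm (w \<omega>))\<^sup>2 * (v - u)" for \<omega>
    define U' where "U' \<omega> = U \<omega> + w \<omega> \<bullet> (B v \<omega> - B u \<omega>)" for \<omega>
    define W' where "W' \<omega> = W \<omega> * exp (a \<omega> / (8 * d\<^sup>2)) * (if \<bar>U' \<omega>\<bar> \<le> d then 1 else 0)" for \<omega>
    have I': "W \<in> bounded_borel (F u)" "U \<in> borel_measurable (F u)" "\<And>\<omega>. 0 \<le> W \<omega>"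
      "\<And>\<omega>. W \<omega> \<noteq> 0 \<Longrightarrow> \<bar>U \<omega>\<bar> \<le> d"
      and UY: "\<And>\<omega>. U \<omega> = Y u \<omega>" and A0: "\<And>\<omega>. 0 \<le> A \<omega>"
      and nnA: "\<And>\<omega>. (\<integral>\<^sup>+r\<in>{s<..u}. ennreal ((norm (simple_process m p \<xi> r \<omega> $ i))\<^sup>2) \<partial>lborel) \<le> ennreal (A \<omega>)"
      and WA: "\<And>\<omega>. (\<forall>q\<in>{s..u}. \<bar>Y q \<omega>\<bar> \<le> d) \<Longrightarrow> exp (A \<omega> / (8 * d\<^sup>2)) \<le> W \<omega>"
      and le: "(\<integral>\<omega>. W \<omega> * (4 * d\<^sup>2 - (U \<omega>)\<^sup>2) \<partial>M) \<le> 4 * d\<^sup>2"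
      using I by blast+
    note next_step = exit_supermartingale_step[OF u0 uv(1) vT d w I'(1,2) I'(3,4) small,
        folded a_def, folded U'_def, folded W'_def]
    have Y': "U' \<omega> = Y v \<omega>" for \<omega>
    proof -
      have "Y v \<omega> - Y u \<omega> = (\<xi> k \<omega> *v (B v \<omega> - B u \<omega>)) $ i"
        unfolding Y_def simple_integral_cell[OF sd k(1,2) less_imp_le[OF uv(1)] k(3), symmetric] by simp
      also have "\<dots> = w \<omega> \<bullet> (B v \<omega> - B u \<omega>)"
        by (simp add: w_def matrix_vector_mult_def inner_vec_def)
      finally show ?thesis using UY[of \<omega>] by (simp add: U'_def)
    qed
    have a0: "0 \<le> a \<omega>" for \<omega> using uv by (simp add: a_def)
    have nn: "(\<integral>\<^sup>+r\<in>{s<..v}. ennreal ((norm (simple_process m p \<xi> r \<omega> $ i))\<^sup>2) \<partial>lborel) \<le> ennreal (A \<omega> + a \<omega>)" for \<omega>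
    proof -
      let ?h = "\<lambda>r. ennreal ((norm (simple_process m p \<xi> r \<omega> $ i))\<^sup>2)"
      have [measurable]: "?h \<in> borel_measurable borel"
        using borel_measurable_vec_nth[OF borel_measurable_simple_process, of m p \<xi> \<omega> i] by measurable
      \<comment> \<open>On the new piece the integrand is constant, so the quadratic variation grows
        by exactly \<open>a\<close>.\<close>
      have "(\<integral>\<^sup>+r\<in>{s<..v}. ?h r \<partial>lborel) = (\<integral>\<^sup>+r. (?h r * indicator {s<..u} r + ennreal ((norm (w \<omega>))\<^sup>2) * indicator {u<..v} r) \<partial>lborel)"
        using u uv k simple_process_cell[OF sd k(1), of _ \<omega>]
        by (intro nn_integral_cong) (auto simp: indicator_def w_def)
      also have "\<dots> = (\<integral>\<^sup>+r\<in>{s<..u}. ?h r \<partial>lborel) + (\<integral>\<^sup>+r. ennreal ((norm (w \<omega>))\<^sup>2) * indicator {u<..v} r \<partial>lborel)"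
        by (intro nn_integral_add) auto
      also have "(\<integral>\<^sup>+r. ennreal ((norm (w \<omega>))\<^sup>2) * indicator {u<..v} r \<partial>lborel) = ennreal (a \<omega>)"
        using uv by (simp add: nn_integral_cmult_indicator a_def ennreal_mult)
      also have "(\<integral>\<^sup>+r\<in>{s<..u}. ?h r \<partial>lborel) \<le> ennreal (A \<omega>)" by (rule nnA)
      finally show ?thesis using A0[of \<omega>] a0[of \<omega>] by simp
    qed
    have "?Inv v W' U' (\<lambda>\<omega>. A \<omega> + a \<omega>)"
    proof (intro conjI allI impI)
      show "W' \<in> bounded_borel (F v)" "U' \<in> borel_measurable (F v)" using next_step by auto
      show "(\<integral>\<omega>. W' \<omega> * (4 * d\<^sup>2 - (U' \<omega>)\<^sup>2) \<partial>M) \<le> 4 * d\<^sup>2"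
        using next_step(3) le by (rule order_trans)
      fix \<omega>
      show "0 \<le> W' \<omega>" using I'(3) by (simp add: W'_def)
      show "W' \<omega> \<noteq> 0 \<Longrightarrow> \<bar>U' \<omega>\<bar> \<le> d" by (auto simp: W'_def split: if_splits)
      show "U' \<omega> = Y v \<omega>" by (rule Y')
      show "0 \<le> A \<omega> + a \<omega>" using A0[of \<omega>] a0[of \<omega>] by simp
      show "(\<integral>\<^sup>+r\<in>{s<..v}. ennreal ((norm (simple_process m p \<xi> r \<omega> $ i))\<^sup>2) \<partial>lborel) \<le> ennreal (A \<omega> + a \<omega>)" by (rule nn)
      assume *: "\<forall>q\<in>{s..v}. \<bar>Y q \<omega>\<bar> \<le> d"
      then have "exp (A \<omega> / (8 * d\<^sup>2)) \<le> W \<omega>" using uv by (intro WA) auto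
      \<comment> \<open>Killing tests only the end point \<open>v\<close>, which belongs to the
        interval on which |Y| is at most \<open>d\<close>.\<close>
      moreover have "\<bar>U' \<omega>\<bar> \<le> d" using * Y' u uv by auto
      ultimately show "exp ((A \<omega> + a \<omega>) / (8 * d\<^sup>2)) \<le> W' \<omega>"
        by (simp add: W'_def add_divide_distrib exp_add)
    qed
    then have ex: "\<exists>W U A. ?Inv v W U A" by (intro exI)
    have "s \<le> v" using u uv by simp
    with ex vT show ?case by (intro conjI)
  qed
  then show ?thesis by blast
qed

text \<open>Markov's inequality for the exit supermartingale. On \<open>E\<close> the weight is at
  least exp (b / (8 d^2)) and 4 d^2 - U^2 is at least 3 d^2, while the expectation of the product is
  at most 4 d^2; this is the origin of 4/3.\<close>

lemma simple_integral_small_oscillation: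
  assumes sd: "simple_data F T m p \<xi>" and st: "0 \<le> s" "s \<le> t" "t \<le> T" and d: "0 < d"
    and E: "E \<in> events"
    and osc: "\<And>\<omega> q. \<omega> \<in> E \<Longrightarrow> q \<in> {s..t} \<Longrightarrow>
      \<bar>simple_integral B m p \<xi> q \<omega> $ i - simple_integral B m p \<xi> s \<omega> $ i\<bar> \<le> d"
    and qv: "\<And>\<omega>. \<omega> \<in> E \<Longrightarrow>
      ennreal b \<le> (\<integral>\<^sup>+r\<in>{s<..t}. ennreal ((norm (simple_process m p \<xi> r \<omega> $ i))\<^sup>2) \<partial>lborel)"
  shows "prob E \<le> 4 / 3 * exp (- b / (8 * d\<^sup>2))"
proof -
  define Y where "Y q \<omega> = simple_integral B m p \<xi> q \<omega> $ i - simple_integral B m p \<xi> s \<omega> $ i" for q \<omega>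
  obtain W U A where W: "W \<in> bounded_borel (F t)" and U: "U \<in> borel_measurable (F t)"
    and inv: "\<forall>\<omega>. 0 \<le> W \<omega> \<and> (W \<omega> \<noteq> 0 \<longrightarrow> \<bar>U \<omega>\<bar> \<le> d) \<and> U \<omega> = Y t \<omega> \<and> 0 \<le> A \<omega> \<and>
      (\<integral>\<^sup>+r\<in>{s<..t}. ennreal ((norm (simple_process m p \<xi> r \<omega> $ i))\<^sup>2) \<partial>lborel) \<le> ennreal (A \<omega>) \<and>
      ((\<forall>q\<in>{s..t}. \<bar>Y q \<omega>\<bar> \<le> d) \<longrightarrow> exp (A \<omega> / (8 * d\<^sup>2)) \<le> W \<omega>)"
    and le: "(\<integral>\<omega>. W \<omega> * (4 * d\<^sup>2 - (U \<omega>)\<^sup>2) \<partial>M) \<le> 4 * d\<^sup>2"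
    using simple_integral_exit_supermartingale[OF sd st d, of i, folded Y_def] by blast
  have W0: "\<And>\<omega>. 0 \<le> W \<omega>" and WU: "\<And>\<omega>. W \<omega> \<noteq> 0 \<Longrightarrow> \<bar>U \<omega>\<bar> \<le> d"
    and A0: "\<And>\<omega>. 0 \<le> A \<omega>"
    and A: "\<And>\<omega>. (\<integral>\<^sup>+r\<in>{s<..t}. ennreal ((norm (simple_process m p \<xi> r \<omega> $ i))\<^sup>2) \<partial>lborel) \<le> ennreal (A \<omega>)"
    and WA: "\<And>\<omega>. (\<forall>q\<in>{s..t}. \<bar>Y q \<omega>\<bar> \<le> d) \<Longrightarrow> exp (A \<omega> / (8 * d\<^sup>2)) \<le> W \<omega>"
    using inv by blast+
  let ?c = "3 * d\<^sup>2 * exp (b / (8 * d\<^sup>2))"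
  have nonneg: "3 * d\<^sup>2 \<le> 4 * d\<^sup>2 - (U \<omega>)\<^sup>2" if "W \<omega> \<noteq> 0" for \<omega>
    using power_mono[OF WU[OF that] abs_ge_zero, of 2] by simp
  have "?c * prob E = (\<integral>\<omega>. ?c * indicator E \<omega> \<partial>M)"
    using E by simp
  also have "\<dots> \<le> (\<integral>\<omega>. W \<omega> * (4 * d\<^sup>2 - (U \<omega>)\<^sup>2) \<partial>M)"
  proof (rule integral_mono)
    show "integrable M (\<lambda>\<omega>. ?c * indicator E \<omega>)"
      using E by (intro integrable_mult_right integrable_real_indicator) (auto simp: emeasure_eq_measure)
    show "integrable M (\<lambda>\<omega>. W \<omega> * (4 * d\<^sup>2 - (U \<omega>)\<^sup>2))"
      using integrable_bounded_borel[OF st(3) bounded_borel_quadratic[OF W U WU]] by simp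
    fix \<omega>
    show "?c * indicator E \<omega> \<le> W \<omega> * (4 * d\<^sup>2 - (U \<omega>)\<^sup>2)"
    proof (cases "\<omega> \<in> E")
      case True
      have "ennreal b \<le> ennreal (A \<omega>)" using qv[OF True] A[of \<omega>] by (rule order_trans)
      then have "b \<le> A \<omega>" using A0[of \<omega>] by (simp add: ennreal_le_iff)
      then have "exp (b / (8 * d\<^sup>2)) \<le> exp (A \<omega> / (8 * d\<^sup>2))" by (simp add: divide_right_mono)
      also have "\<dots> \<le> W \<omega>" using osc[OF True] by (intro WA) (auto simp: Y_def)
      finally have bW: "exp (b / (8 * d\<^sup>2)) \<le> W \<omega>" .
      then have "W \<omega> \<noteq> 0" using exp_gt_zero[of "b / (8 * d\<^sup>2)"] by linarith
      from nonneg[OF this] have "exp (b / (8 * d\<^sup>2)) * (3 * d\<^sup>2) \<le> W \<omega> * (4 * d\<^sup>2 - (U \<omega>)\<^sup>2)"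
        using bW W0[of \<omega>] by (intro mult_mono) auto
      then show ?thesis using True by (simp add: ac_simps)
    next
      case False
      \<comment> \<open>The integrand stays nonnegative off \<open>E\<close>, because
        \<open>W\<close> vanishes where |U| exceeds \<open>d\<close>.\<close>
      have "0 \<le> W \<omega> * (4 * d\<^sup>2 - (U \<omega>)\<^sup>2)"
      proof (cases "W \<omega> = 0")
        case False
        have "0 \<le> 4 * d\<^sup>2 - (U \<omega>)\<^sup>2"
          using nonneg[OF False] zero_le_power2[of d] by linarith
        with W0[of \<omega>] show ?thesis by (rule mult_nonneg_nonneg)
      qed simp
      then show ?thesis using False by simp
    qed
  qed
  also note le
  finally have "3 * d\<^sup>2 * (exp (b / (8 * d\<^sup>2)) * prob E) \<le> 3 * d\<^sup>2 * (4 / 3)" by (simp add: mult.assoc)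
  then have "exp (b / (8 * d\<^sup>2)) * prob E \<le> 4 / 3"
    using d by (subst (asm) mult_le_cancel_left_pos) auto
  then have "exp (- b / (8 * d\<^sup>2)) * (exp (b / (8 * d\<^sup>2)) * prob E) \<le> exp (- b / (8 * d\<^sup>2)) * (4 / 3)"
    by (rule mult_left_mono) simp
  moreover have "exp (- b / (8 * d\<^sup>2)) * exp (b / (8 * d\<^sup>2)) = 1"
    by (simp flip: exp_add)
  ultimately have "prob E \<le> exp (- b / (8 * d\<^sup>2)) * (4 / 3)"
    by (simp only: mult.assoc[symmetric] mult_1_left)
  then show ?thesis by linarith
qed

end

section \<open>Passage to stochastic integrals\<close>

context brownian
begin

text \<open>Outside two events of vanishing probability, the approximating integral is within d/2 of
  \<open>X\<close> at all times, so it oscillates by at most 2 d; and |\<sigma>|^2 \<le> 2 |H|^2 + 2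
  |H - \<sigma>|^2, with an error integral of at most b/4, leaves it a quadratic variation of at
  least b/4. Hence 128 = 8 * 4 * 4.\<close>

lemma ito_small_oscillation:
  assumes ito: "is_ito_integral M F B T \<sigma> X"
    and st: "0 \<le> s" "s \<le> t" "t \<le> T" and d: "0 < d" and b: "0 \<le> b" and E: "E \<in> events"
    and osc: "AE \<omega> in M. \<omega> \<in> E \<longrightarrow> (\<forall>q\<in>{s..t}. \<bar>X q \<omega> $ i - X s \<omega> $ i\<bar> \<le> d)"
    and qv: "AE \<omega> in M. \<omega> \<in> E \<longrightarrow>
      ennreal b \<le> (\<integral>\<^sup>+r\<in>{s<..t}. ennreal ((norm (\<sigma> r \<omega> $ i))\<^sup>2) \<partial>lborel)"
  shows "prob E \<le> 4 / 3 * exp (- b / (128 * d\<^sup>2))"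
proof -
  obtain m p \<xi> where sd: "\<And>j. simple_data F T (m j) (p j) (\<xi> j)"
    and lim1: "tends_to_0_in_prob M (\<lambda>j \<omega>. \<integral>\<^sup>+t\<in>{0..T}.
          ennreal ((norm (simple_process (m j) (p j) (\<xi> j) t \<omega> - \<sigma> t \<omega>))\<^sup>2) \<partial>lborel)"
    and lim2: "tends_to_0_in_prob M (\<lambda>j \<omega>. SUP t\<in>{0..T}.
          ennreal (norm (simple_integral B (m j) (p j) (\<xi> j) t \<omega> - X t \<omega>)))"
    using ito unfolding is_ito_integral_def by blast
  define H where "H j r \<omega> = simple_process (m j) (p j) (\<xi> j) r \<omega>" for j r \<omega>
  define Y where "Y j q \<omega> = simple_integral B (m j) (p j) (\<xi> j) q \<omega>" for j q \<omega>
  define Z1 where "Z1 j \<omega> = (\<integral>\<^sup>+t\<in>{0..T}. ennreal ((norm (H j t \<omega> - \<sigma> t \<omega>))\<^sup>2) \<partial>lborel)" for j \<omega>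
  define Z2 where "Z2 j \<omega> = (SUP t\<in>{0..T}. ennreal (norm (Y j t \<omega> - X t \<omega>)))" for j \<omega>
  have Z1m: "\<And>j. Z1 j \<in> borel_measurable M" and Z2m: "\<And>j. Z2 j \<in> borel_measurable M"
    and Z1l: "\<And>e::real. e > 0 \<Longrightarrow> (\<lambda>j. prob {\<omega> \<in> space M. ennreal e < Z1 j \<omega>}) \<longlonglongrightarrow> 0"
    and Z2l: "\<And>e::real. e > 0 \<Longrightarrow> (\<lambda>j. prob {\<omega> \<in> space M. ennreal e < Z2 j \<omega>}) \<longlonglongrightarrow> 0"
    using lim1 lim2 unfolding tends_to_0_in_prob_def Z1_def Z2_def H_def Y_def by blast+
  have jm: "(\<lambda>(t, \<omega>). \<sigma> t \<omega>) \<in> borel_measurable (restrict_space borel {0..T} \<Otimes>\<^sub>M M)"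
    using ito by (simp add: is_ito_integral_def)
  from osc qv have "AE \<omega> in M. \<omega> \<in> E \<longrightarrow> (\<forall>q\<in>{s..t}. \<bar>X q \<omega> $ i - X s \<omega> $ i\<bar> \<le> d) \<and>
      ennreal b \<le> (\<integral>\<^sup>+r\<in>{s<..t}. ennreal ((norm (\<sigma> r \<omega> $ i))\<^sup>2) \<partial>lborel)"
    by eventually_elim auto
  then obtain N where N: "N \<in> null_sets M" and ok: "\<And>\<omega>. \<omega> \<in> E - N \<Longrightarrow>
      (\<forall>q\<in>{s..t}. \<bar>X q \<omega> $ i - X s \<omega> $ i\<bar> \<le> d) \<and>
      ennreal b \<le> (\<integral>\<^sup>+r\<in>{s<..t}. ennreal ((norm (\<sigma> r \<omega> $ i))\<^sup>2) \<partial>lborel)"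
    using sets.sets_into_space[OF E] unfolding eventually_ae_filter by blast
  show ?thesis
  \<comment> \<open>Convergence in probability is used at the threshold b/4, which must be positive;
    for b = 0 the claimed bound exceeds 1.\<close>
  proof (cases "b = 0")
    case True
    have "prob E \<le> 4 / 3" using prob_le_1[of E] by linarith
    with True show ?thesis by simp
  next
    case False
    with b have b: "0 < b" by simp
    let ?b1 = "\<lambda>j. {\<omega> \<in> space M. ennreal (b / 4) < Z1 j \<omega>}"
    let ?b2 = "\<lambda>j. {\<omega> \<in> space M. ennreal (d / 2) < Z2 j \<omega>}"
    let ?c = "4 / 3 * exp (- b / (128 * d\<^sup>2))"
    have le: "prob E \<le> ?c + prob (?b1 j) + prob (?b2 j)" for j
    proof -
      \<comment> \<open>Removing the null set as well turns the almost sure hypotheses into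
        pointwise ones.\<close>
      define G where "G = E - N - ?b1 j - ?b2 j"
      have bm: "?b1 j \<in> events" "?b2 j \<in> events" "N \<in> events"
        using Z1m Z2m N by auto
      then have G: "G \<in> events" using E by (auto simp: G_def)
      have "prob G \<le> 4 / 3 * exp (- (b / 4) / (8 * (2 * d)\<^sup>2))"
      proof (rule simple_integral_small_oscillation[OF sd st _ G, where i = i])
        fix \<omega> q assume \<omega>: "\<omega> \<in> G" and q: "q \<in> {s..t}"
        have Z: "Z2 j \<omega> \<le> ennreal (d / 2)" and oE: "\<omega> \<in> E - N"
          using \<omega> sets.sets_into_space[OF E] by (auto simp: G_def)
        have close: "\<bar>Y j r \<omega> $ i - X r \<omega> $ i\<bar> \<le> d / 2" if "r \<in> {s..t}" for r
        proof -
          have "ennreal (norm (Y j r \<omega> - X r \<omega>)) \<le> Z2 j \<omega>"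
            unfolding Z2_def using that st by (intro SUP_upper) auto
          then have "ennreal (norm (Y j r \<omega> - X r \<omega>)) \<le> ennreal (d / 2)" using Z by (rule order_trans)
          then have "norm (Y j r \<omega> - X r \<omega>) \<le> d / 2" using d by (simp add: ennreal_le_iff)
          then show ?thesis using component_le_norm_cart[of "Y j r \<omega> - X r \<omega>" i] by simp
        qed
        have s_in: "s \<in> {s..t}" using st by simp
        have "\<bar>X q \<omega> $ i - X s \<omega> $ i\<bar> \<le> d" using ok[OF oE] q by blast
        then have "\<bar>Y j q \<omega> $ i - Y j s \<omega> $ i\<bar> \<le> 2 * d"
          using close[OF q] close[OF s_in] by linarith
        then show "\<bar>simple_integral B (m j) (p j) (\<xi> j) q \<omega> $ i - simple_integral B (m j) (p j) (\<xi> j) s \<omega> $ i\<bar> \<le> 2 * d"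
          by (simp add: Y_def)
      next
        fix \<omega> assume \<omega>: "\<omega> \<in> G"
        have Z: "Z1 j \<omega> \<le> ennreal (b / 4)" and oE: "\<omega> \<in> E - N" and sp: "\<omega> \<in> space M"
          using \<omega> sets.sets_into_space[OF E] by (auto simp: G_def)
        let ?f = "\<lambda>r. ennreal ((norm (H j r \<omega> $ i))\<^sup>2)"
        let ?g = "\<lambda>r. ennreal ((norm (H j r \<omega> - \<sigma> r \<omega>))\<^sup>2)"
        have Hm: "(\<lambda>r. H j r \<omega>) \<in> borel_measurable borel"
          unfolding H_def by measurable
        have "(\<lambda>r. \<sigma> r \<omega>) \<in> borel_measurable (restrict_space borel {0..T})"
          using measurable_Pair1[OF jm sp] by simp
        then have sm: "(\<lambda>r. H j r \<omega> - \<sigma> r \<omega>) \<in> borel_measurable (restrict_space borel {0..T})"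
          using measurable_restrict_space1[OF Hm] by measurable
        then have "?g \<in> borel_measurable (restrict_space borel {0..T})" by measurable
        then have gm: "(\<lambda>r. ?g r * indicator {0..T} r) \<in> borel_measurable borel"
          by (subst (asm) borel_measurable_restrict_space_iff_ennreal) auto
        have fm: "?f \<in> borel_measurable borel"
          using borel_measurable_vec_nth[OF Hm, of i] by measurable
        have pw: "ennreal ((norm (\<sigma> r \<omega> $ i))\<^sup>2) \<le> 2 * ?f r + 2 * ?g r" for r
        proof -
          let ?x = "norm (H j r \<omega> $ i)" and ?y = "norm (H j r \<omega> - \<sigma> r \<omega>)"
          have "norm (\<sigma> r \<omega> $ i) \<le> ?x + norm ((H j r \<omega> - \<sigma> r \<omega>) $ i)"
            using norm_triangle_ineq4[of "H j r \<omega> $ i" "(H j r \<omega> - \<sigma> r \<omega>) $ i"] by simp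
          also have "\<dots> \<le> ?x + ?y"
            by (intro add_left_mono Finite_Cartesian_Product.norm_nth_le)
          finally have "(norm (\<sigma> r \<omega> $ i))\<^sup>2 \<le> (?x + ?y)\<^sup>2" by (rule power_mono) simp
          also have "\<dots> \<le> 2 * ?x\<^sup>2 + 2 * ?y\<^sup>2"
            using zero_le_power2[of "?x - ?y"] unfolding power2_sum power2_diff by linarith
          finally have "ennreal ((norm (\<sigma> r \<omega> $ i))\<^sup>2) \<le> ennreal (2 * ?x\<^sup>2 + 2 * ?y\<^sup>2)"
            by (rule ennreal_leI)
          then show ?thesis by (simp add: ennreal_plus ennreal_mult)
        qed
        let ?I = "\<integral>\<^sup>+r\<in>{s<..t}. ?f r \<partial>lborel"
        have "ennreal b \<le> (\<integral>\<^sup>+r\<in>{s<..t}. ennreal ((norm (\<sigma> r \<omega> $ i))\<^sup>2) \<partial>lborel)"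
          using ok[OF oE] by blast
        also have "\<dots> \<le> (\<integral>\<^sup>+r. (2 * (?f r * indicator {s<..t} r) + 2 * (?g r * indicator {0..T} r)) \<partial>lborel)"
          using pw st by (intro nn_integral_mono) (auto simp: indicator_def)
        also have "\<dots> = 2 * ?I + 2 * Z1 j \<omega>"
          unfolding Z1_def using fm gm
          by (subst nn_integral_add) (auto simp: nn_integral_cmult)
        also have "\<dots> \<le> 2 * ?I + 2 * ennreal (b / 4)"
          using Z by (intro add_left_mono mult_left_mono) auto
        also have "\<dots> = 2 * ?I + ennreal (b / 2)"
          using b by (simp add: ennreal_mult[symmetric] del: ennreal_numeral flip: ennreal_numeral)
        finally have le: "ennreal b \<le> 2 * ?I + ennreal (b / 2)" .
        have "ennreal (b / 4) \<le> ?I"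
        proof (cases ?I rule: ennreal_cases)
          case (real x)
          have "ennreal b \<le> ennreal (2 * x + b / 2)"
            using le real b by (simp add: ennreal_plus ennreal_mult)
          then have "b \<le> 2 * x + b / 2"
            by (subst (asm) ennreal_le_iff) (use real b in auto)
          then show ?thesis using real by (simp add: ennreal_leI)
        qed simp
        then show "ennreal (b / 4) \<le> (\<integral>\<^sup>+r\<in>{s<..t}. ennreal ((norm (simple_process (m j) (p j) (\<xi> j) r \<omega> $ i))\<^sup>2) \<partial>lborel)"
          by (simp add: H_def)
      qed (use d in simp)
      also have "(b / 4) / (8 * (2 * d)\<^sup>2) = b / (128 * d\<^sup>2)" by (simp add: power_mult_distrib)
      then have "- (b / 4) / (8 * (2 * d)\<^sup>2) = - b / (128 * d\<^sup>2)" by simp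
      finally have Gle: "prob G \<le> ?c" .
      have "prob E \<le> prob (((G \<union> ?b1 j) \<union> ?b2 j) \<union> N)"
        using G bm by (intro finite_measure_mono) (auto simp: G_def)
      also have "\<dots> \<le> prob ((G \<union> ?b1 j) \<union> ?b2 j) + prob N"
        using G bm by (intro measure_Un_le) auto
      also have "prob N = 0" using N by (simp add: measure_eq_0_null_sets)
      also have "prob ((G \<union> ?b1 j) \<union> ?b2 j) \<le> prob (G \<union> ?b1 j) + prob (?b2 j)"
        using G bm by (intro measure_Un_le) auto
      also have "prob (G \<union> ?b1 j) \<le> prob G + prob (?b1 j)"
        using G bm by (intro measure_Un_le) auto
      finally show ?thesis using Gle by simp
    qed
    \<comment> \<open>The constant \<open>?c\<close> does not depend on \<open>j\<close>, so the two
      error probabilities can be sent to 0.\<close>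
    have "(\<lambda>j. ?c + prob (?b1 j) + prob (?b2 j)) \<longlonglongrightarrow> ?c + 0 + 0"
      using b d by (intro tendsto_add tendsto_const Z1l Z2l) auto
    then have "prob E \<le> ?c + 0 + 0"
      by (rule LIMSEQ_le_const) (use le in blast)
    then show ?thesis by simp
  qed
qed

lemma ito_quadratic_variation_measurable:
  assumes ito: "is_ito_integral M F B T \<sigma> X" and st: "0 \<le> s" "t \<le> T" "0 \<le> T"
  shows "(\<lambda>\<omega>. \<integral>\<^sup>+r\<in>{s<..t}. ennreal ((norm (\<sigma> r \<omega> $ i))\<^sup>2) \<partial>lborel) \<in> borel_measurable M"
proof -
  \<comment> \<open>\<sigma> is jointly measurable only for times in [0, T]; clamping the time
    extends it measurably and changes nothing between \<open>s\<close> and \<open>t\<close>.\<close>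
  let ?c = "\<lambda>r. max 0 (min T r)"
  have jm: "(\<lambda>(t, \<omega>). \<sigma> t \<omega>) \<in> borel_measurable (restrict_space borel {0..T} \<Otimes>\<^sub>M M)"
    using ito by (simp add: is_ito_integral_def)
  have "(\<lambda>x. ?c (snd x)) \<in> M \<Otimes>\<^sub>M lborel \<rightarrow>\<^sub>M restrict_space borel {0..T}"
    using st by (intro measurable_restrict_space2) auto
  then have "(\<lambda>x. (?c (snd x), fst x)) \<in> M \<Otimes>\<^sub>M lborel \<rightarrow>\<^sub>M restrict_space borel {0..T} \<Otimes>\<^sub>M M"
    by measurable
  from measurable_compose[OF this jm]
  have "(\<lambda>x. \<sigma> (?c (snd x)) (fst x) $ i) \<in> borel_measurable (M \<Otimes>\<^sub>M lborel)"
    by (intro borel_measurable_vec_nth) simp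
  then have "(\<lambda>(\<omega>, r). ennreal ((norm (\<sigma> (?c r) \<omega> $ i))\<^sup>2) * indicator {s<..t} r) \<in> borel_measurable (M \<Otimes>\<^sub>M lborel)"
    unfolding case_prod_beta by measurable
  then have "(\<lambda>\<omega>. \<integral>\<^sup>+r\<in>{s<..t}. ennreal ((norm (\<sigma> (?c r) \<omega> $ i))\<^sup>2) \<partial>lborel) \<in> borel_measurable M"
    by (rule lborel.borel_measurable_nn_integral)
  moreover have "(\<integral>\<^sup>+r\<in>{s<..t}. ennreal ((norm (\<sigma> (?c r) \<omega> $ i))\<^sup>2) \<partial>lborel)
      = (\<integral>\<^sup>+r\<in>{s<..t}. ennreal ((norm (\<sigma> r \<omega> $ i))\<^sup>2) \<partial>lborel)" for \<omega>
    using st by (intro nn_integral_cong) (auto simp: indicator_def)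
  ultimately show ?thesis by simp
qed

end

section \<open>Borel--Cantelli over refining grids\<close>

lemma summable_mult_exp_powr:
  fixes c a :: real
  assumes c: "0 < c" and a: "0 < a"
  shows "summable (\<lambda>n. real n * exp (- (c * real n powr a)))"
proof -
  \<comment> \<open>As a m > 3, the single term x^m / m! of the exponential series makes exp (- x)
    of order n^(-3) for x = c n^a; the extra factor n leaves the summable n^(-2).\<close>
  obtain m :: nat where m: "3 / a < real m" using reals_Archimedean2 by blast
  have am: "3 < a * real m" using m a by (simp add: field_simps)
  have "norm (real n * exp (- (c * real n powr a))) \<le> fact m / c ^ m * real n powr (- 2)" if "n \<ge> 1" for n
  proof -
    let ?x = "c * real n powr a"
    have x: "0 < ?x" using c that by simp
    have "?x ^ m / fact m \<le> exp ?x"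
    proof -
      have "(\<Sum>k\<in>{m}. ?x ^ k /\<^sub>R fact k) \<le> (\<Sum>k. ?x ^ k /\<^sub>R fact k)"
        using x by (intro sum_le_suminf summable_exp_generic) auto
      then show ?thesis by (simp add: exp_def divide_inverse ac_simps)
    qed
    then have "exp (- ?x) \<le> fact m / ?x ^ m"
      using le_imp_inverse_le[of "?x ^ m / fact m" "exp ?x"] x by (simp add: exp_minus)
    also have "\<dots> = fact m / c ^ m * real n powr (- (a * real m))"
      using that by (simp add: power_mult_distrib powr_powr powr_minus_divide flip: powr_realpow)
    also have "\<dots> \<le> fact m / c ^ m * real n powr (- 3)"
      using am that c by (intro mult_left_mono powr_mono) auto
    finally have "real n * exp (- ?x) \<le> real n * (fact m / c ^ m * real n powr (- 3))"
      by (rule mult_left_mono) simp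
    also have "\<dots> = fact m / c ^ m * (real n powr 1 * real n powr (- 3))"
      using that by simp
    also have "\<dots> = fact m / c ^ m * real n powr (- 2)"
      by (subst powr_add[symmetric]) simp
    finally show ?thesis by simp
  qed
  moreover have "summable (\<lambda>n. fact m / c ^ m * real n powr (- 2))"
    by (intro summable_mult) (simp add: summable_real_powr_iff)
  ultimately show ?thesis by (rule summable_comparison_test'[rotated])
qed

text \<open>Lets small oscillation of a continuous path be tested at countably many times, which
  makes the event measurable.\<close>

lemma continuous_le_from_rationals:
  fixes f :: "real \<Rightarrow> real"
  assumes f: "continuous_on {s..t} f" and "s < t" and le: "\<And>q. q \<in> {s<..<t} \<inter> \<rat> \<Longrightarrow> f q \<le> c"
    and x: "x \<in> {s..t}"
  shows "f x \<le> c"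
proof -
  have "closure ({s<..<t} \<inter> \<rat>) = closure {s<..<t}"
    by (rule closure_open_Int_superset) (auto simp: Rats_closure_real)
  then have cl: "closure ({s<..<t} \<inter> \<rat>) = {s..t}"
    using \<open>s < t\<close> by (simp add: closure_greaterThanLessThan)
  show ?thesis
    by (rule continuous_le_on_closure[of "{s<..<t} \<inter> \<rat>" f x c, unfolded cl, OF f x le])
qed

context brownian
begin

text \<open>For oscillation n powr - (1/2 + \<eta>) and quadratic variation \<kappa> / n, the
  exponent in \<open>ito_small_oscillation\<close> is of order n powr (2 \<eta>), which beats the
  number n of intervals. Since \<kappa> is deterministic, the size of the quadratic variation enters
  as a condition on the path.\<close>

lemma ito_oscillation_lower_bound:
  assumes ito: "is_ito_integral M F B T \<sigma> X" and T: "0 < T" and \<kappa>: "0 < \<kappa>" and \<eta>: "0 < \<eta>"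
  shows "AE \<omega> in M. eventually (\<lambda>n. \<forall>k<n. \<forall>i.
    ennreal (\<kappa> / n) \<le> (\<integral>\<^sup>+r\<in>{k * T / n<..Suc k * T / n}. ennreal ((norm (\<sigma> r \<omega> $ i))\<^sup>2) \<partial>lborel) \<longrightarrow>
    (\<exists>u\<in>{k * T / n..Suc k * T / n}. real n powr - (1 / 2 + \<eta>) < \<bar>X u \<omega> $ i - X (k * T / n) \<omega> $ i\<bar>)) sequentially"
proof -
  define g where "g n k = real k * T / real n" for n k :: nat
  define \<delta> where "\<delta> n = real n powr - (1 / 2 + \<eta>)" for n :: nat
  define Q where "Q n k \<omega> i = (\<integral>\<^sup>+r\<in>{g n k<..g n (Suc k)}. ennreal ((norm (\<sigma> r \<omega> $ i))\<^sup>2) \<partial>lborel)" for n k \<omega> i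
  \<comment> \<open>Only rational times strictly inside the interval are tested; continuity of
    almost every path gives back the whole closed interval.\<close>
  define E where "E n k i = {\<omega> \<in> space M.
    (\<forall>q\<in>{g n k<..<g n (Suc k)} \<inter> \<rat>. \<bar>X q \<omega> $ i - X (g n k) \<omega> $ i\<bar> \<le> \<delta> n) \<and> ennreal (\<kappa> / n) \<le> Q n k \<omega> i}" for n k i
  have g: "0 \<le> g n k" "g n k < g n (Suc k)" "g n (Suc k) \<le> T" if "k < n" for n k
    using that T mult_left_mono[of "real (Suc k)" "real n" T] by (auto simp: g_def field_simps)
  have Xm: "X q \<in> borel_measurable M" if "q \<in> {0..T}" for q
  proof (rule measurable_F)
    show "X q \<in> borel_measurable (F q)"
      using ito that unfolding is_ito_integral_def by blast
  qed (use that in simp)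
  have cont: "AE \<omega> in M. continuous_on {0..T} (\<lambda>t. X t \<omega>)"
    using ito by (simp add: is_ito_integral_def)
  have Em: "E n k i \<in> events" if "k < n" for n k i
  proof -
    note g = g[OF that]
    have [measurable]: "(\<lambda>\<omega>. X q \<omega> $ i) \<in> borel_measurable M" if "q \<in> {g n k..g n (Suc k)}" for q
      using that g by (intro borel_measurable_vec_nth Xm) auto
    have [measurable]: "(\<lambda>\<omega>. Q n k \<omega> i) \<in> borel_measurable M"
      unfolding Q_def using g T by (intro ito_quadratic_variation_measurable[OF ito]) auto
    have [measurable]: "Measurable.pred M (\<lambda>\<omega>. \<forall>q\<in>{g n k<..<g n (Suc k)} \<inter> \<rat>. \<bar>X q \<omega> $ i - X (g n k) \<omega> $ i\<bar> \<le> \<delta> n)"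
    proof -
      \<comment> \<open>Measurability survives a quantifier over the countable type
        \<open>rat\<close>.\<close>
      have "(\<forall>q\<in>{g n k<..<g n (Suc k)} \<inter> \<rat>. P q) \<longleftrightarrow>
          (\<forall>r::rat. of_rat r \<in> {g n k<..<g n (Suc k)} \<longrightarrow> P (of_rat r))" for P
        by (auto simp: Rats_def)
      moreover have "Measurable.pred M (\<lambda>\<omega>. of_rat r \<in> {g n k<..<g n (Suc k)} \<longrightarrow>
          \<bar>X (of_rat r) \<omega> $ i - X (g n k) \<omega> $ i\<bar> \<le> \<delta> n)" for r :: rat
      proof (cases "of_rat r \<in> {g n k<..<g n (Suc k)}")
        case True
        then have "(\<lambda>\<omega>. X (of_rat r) \<omega> $ i) \<in> borel_measurable M" "(\<lambda>\<omega>. X (g n k) \<omega> $ i) \<in> borel_measurable M"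
          using g by auto
        then show ?thesis by measurable
      qed simp
      ultimately show ?thesis by (simp only: pred_intros_countable)
    qed
    show ?thesis unfolding E_def by measurable
  qed
  have osc: "\<bar>X u \<omega> $ i - X (g n k) \<omega> $ i\<bar> \<le> \<delta> n"
    if "k < n" and "continuous_on {0..T} (\<lambda>t. X t \<omega>)" and "\<omega> \<in> E n k i" and u: "u \<in> {g n k..g n (Suc k)}" for n k i u \<omega>
  proof (rule continuous_le_from_rationals[OF _ g(2)[OF that(1)] _ u])
    show "continuous_on {g n k..g n (Suc k)} (\<lambda>u. \<bar>X u \<omega> $ i - X (g n k) \<omega> $ i\<bar>)"
      by (intro continuous_intros continuous_on_subset[OF that(2)]) (use g[OF that(1)] in auto)
  qed (use that in \<open>auto simp: E_def\<close>)
  have prob_E: "prob (E n k i) \<le> 4 / 3 * exp (- (\<kappa> / 128 * real n powr (2 * \<eta>)))" if "k < n" for n k i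
  proof -
    have n: "0 < real n" using that by simp
    have "prob (E n k i) \<le> 4 / 3 * exp (- (\<kappa> / n) / (128 * (\<delta> n)\<^sup>2))"
    proof (rule ito_small_oscillation[OF ito])
      show "AE \<omega> in M. \<omega> \<in> E n k i \<longrightarrow> (\<forall>q\<in>{g n k..g n (Suc k)}. \<bar>X q \<omega> $ i - X (g n k) \<omega> $ i\<bar> \<le> \<delta> n)"
        using cont by eventually_elim (use osc[OF that] in blast)
      show "AE \<omega> in M. \<omega> \<in> E n k i \<longrightarrow> ennreal (\<kappa> / n) \<le>
          (\<integral>\<^sup>+r\<in>{g n k<..g n (Suc k)}. ennreal ((norm (\<sigma> r \<omega> $ i))\<^sup>2) \<partial>lborel)"
        by (auto simp: E_def Q_def)
    qed (use g[OF that] Em[OF that] \<kappa> n in \<open>auto simp: \<delta>_def\<close>)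
    also have "(\<delta> n)\<^sup>2 = real n powr (- 1 - 2 * \<eta>)"
    proof -
      have "(\<delta> n)\<^sup>2 = real n powr (- (1 / 2 + \<eta>) + - (1 / 2 + \<eta>))"
        by (simp only: \<delta>_def power2_eq_square powr_add)
      also have "- (1 / 2 + \<eta>) + - (1 / 2 + \<eta>) = - 1 - 2 * \<eta>" by simp
      finally show ?thesis .
    qed
    also have "- (\<kappa> / n) / (128 * real n powr (- 1 - 2 * \<eta>)) = - (\<kappa> / 128 * real n powr (2 * \<eta>))"
      using n by (simp add: powr_diff powr_minus field_simps)
    finally show ?thesis .
  qed
  define A where "A n = (\<Union>(k, i)\<in>{..<n} \<times> UNIV. E n k i)" for n
  have Am: "A n \<in> events" for n
    unfolding A_def using Em by (intro sets.finite_UN) auto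
  have prob_A: "prob (A n) \<le> 4 / 3 * CARD('d) * (real n * exp (- (\<kappa> / 128 * real n powr (2 * \<eta>))))" for n
  proof -
    have "prob (A n) \<le> (\<Sum>(k, i)\<in>{..<n} \<times> UNIV. prob (E n k i))"
      unfolding A_def case_prod_beta
      by (rule finite_measure_subadditive_finite) (use Em in auto)
    also have "\<dots> \<le> (\<Sum>(k, i)\<in>{..<n} \<times> (UNIV :: 'd set). 4 / 3 * exp (- (\<kappa> / 128 * real n powr (2 * \<eta>))))"
      by (intro sum_mono) (use prob_E in auto)
    also have "\<dots> = 4 / 3 * CARD('d) * (real n * exp (- (\<kappa> / 128 * real n powr (2 * \<eta>))))"
      by (simp add: card_cartesian_product)
    finally show ?thesis .
  qed
  have "summable (\<lambda>n. prob (A n))"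
  proof (rule summable_comparison_test')
    show "summable (\<lambda>n. 4 / 3 * CARD('d) * (real n * exp (- (\<kappa> / 128 * real n powr (2 * \<eta>)))))"
      using \<kappa> \<eta> by (intro summable_mult summable_mult_exp_powr) auto
    show "norm (prob (A n)) \<le> 4 / 3 * CARD('d) * (real n * exp (- (\<kappa> / 128 * real n powr (2 * \<eta>))))" for n
      using prob_A[of n] by simp
  qed
  then have "AE \<omega> in M. eventually (\<lambda>n. \<omega> \<in> space M - A n) sequentially"
    using Am by (intro borel_cantelli_AE1) (auto simp: emeasure_eq_measure)
  then show ?thesis
  proof eventually_elim
    case (elim \<omega>)
    then show ?case
    proof eventually_elim
      case (elim n)
      show ?case
      proof (intro allI impI)
        fix k i assume k: "k < n" and
          q: "ennreal (\<kappa> / n) \<le> (\<integral>\<^sup>+r\<in>{k * T / n<..Suc k * T / n}. ennreal ((norm (\<sigma> r \<omega> $ i))\<^sup>2) \<partial>lborel)"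
        have "\<omega> \<notin> E n k i" "\<omega> \<in> space M" using elim k by (auto simp: A_def)
        moreover have "ennreal (\<kappa> / n) \<le> Q n k \<omega> i" using q by (simp only: Q_def g_def)
        ultimately have "\<not> (\<forall>q\<in>{g n k<..<g n (Suc k)} \<inter> \<rat>. \<bar>X q \<omega> $ i - X (g n k) \<omega> $ i\<bar> \<le> \<delta> n)"
          unfolding E_def by blast
        then obtain u where "u \<in> {g n k<..<g n (Suc k)}" "\<delta> n < \<bar>X u \<omega> $ i - X (g n k) \<omega> $ i\<bar>"
          unfolding not_le[symmetric] by blast
        then show "\<exists>u\<in>{k * T / n..Suc k * T / n}. real n powr - (1 / 2 + \<eta>) < \<bar>X u \<omega> $ i - X (k * T / n) \<omega> $ i\<bar>"
          unfolding g_def \<delta>_def by (intro bexI[of _ u]) simp_all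
      qed
    qed
  qed
qed

end

section \<open>Oscillation and interval lengths\<close>

text \<open>A pathwise comparison of scales. An interval of length L contains a whole cell of mesh
  T/n once T/n \<le> L/2. In that cell \<open>S\<close> moves by more than n powr - \<alpha>, yet
  any two of its values in the interval differ by at most 2 D; this bounds 1/n, and n is at most a
  constant times 1/L.\<close>

lemma interval_length_from_oscillation:
  fixes S :: "real \<Rightarrow> 'b::real_normed_vector" and T :: real
  assumes T: "0 < T" and \<alpha>: "0 < \<alpha>" and n0: "1 \<le> n0"
    and osc: "\<And>n k. n0 \<le> n \<Longrightarrow> k < n \<Longrightarrow>
      \<exists>u\<in>{k * T / n..Suc k * T / n}. real n powr - \<alpha> < norm (S u - S (k * T / n))"
    and ac: "0 \<le> a" "a < c" "c \<le> T"
    and small: "\<And>u. u \<in> {a<..c} \<Longrightarrow> norm (S u - S a) \<le> D"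
  shows "c - a \<le> 3 * T * real n0 * (2 * D) powr (1 / \<alpha>)"
proof -
  define L where "L = c - a"
  have L: "0 < L" "L \<le> T" using ac by (auto simp: L_def)
  \<comment> \<open>The ceiling is the first level with mesh at most L/2; the maximum with
    \<open>n0\<close> makes \<open>osc\<close> applicable.\<close>
  define n where "n = max n0 (nat \<lceil>2 * T / L\<rceil>)"
  have n: "n0 \<le> n" "0 < n" using n0 by (auto simp: n_def)
  have "2 * T / L \<le> real (nat \<lceil>2 * T / L\<rceil>)" by (rule real_nat_ceiling_ge)
  then have "2 * T / L \<le> real n" by (simp add: n_def)
  then have nL: "2 * T / n \<le> L" using L n T by (simp add: field_simps)
  \<comment> \<open>Rounding is absorbed by 1 \<le> T/L, and the factor \<open>n0\<close> covers the
    case in which the maximum is \<open>n0\<close>.\<close>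
  have nle: "real n \<le> 3 * T * real n0 / L"
  proof -
    have TL: "1 \<le> T / L" using L by simp
    have "real (nat \<lceil>2 * T / L\<rceil>) \<le> 2 * T / L + 1"
      using T L by (simp add: of_nat_nat order_less_imp_le)
    also have "\<dots> \<le> 3 * (T / L)" using TL by simp
    also have "\<dots> \<le> 3 * (T / L) * real n0"
      using TL n0 mult_left_mono[of 1 "real n0" "3 * (T / L)"] by simp
    finally have 1: "real (nat \<lceil>2 * T / L\<rceil>) \<le> 3 * T * real n0 / L" by simp
    have "1 * real n0 \<le> 3 * (T / L) * real n0" using TL by (intro mult_right_mono) auto
    then have "real n0 \<le> 3 * T * real n0 / L" by simp
    with 1 show ?thesis by (simp add: n_def max_def)
  qed
  \<comment> \<open>The first grid point not before \<open>a\<close>; the cell after it ends before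
    a + 2 T/n, hence inside the interval.\<close>
  define k where "k = nat \<lceil>a * n / T\<rceil>"
  have "0 \<le> a * n / T" using ac T by simp
  then have kl: "a * n / T \<le> real k" and ku: "real k < a * n / T + 1"
    unfolding k_def by linarith+
  have ak: "a \<le> k * T / n"
    using kl T n by (simp add: field_simps)
  have "real (Suc k) * T / n \<le> (a * n / T + 2) * T / n"
    using ku T by (intro divide_right_mono mult_right_mono) auto
  also have "\<dots> = a + 2 * T / n" using T n by (simp add: field_simps)
  also have "\<dots> \<le> c" using nL by (simp add: L_def)
  finally have kc: "real (Suc k) * T / n \<le> c" .
  then have "real (Suc k) * T / n \<le> T" using ac by simp
  then have "T * real (Suc k) \<le> T * real n" using n by (simp add: field_simps)
  then have "real (Suc k) \<le> real n" using T by (simp only: mult_le_cancel_left_pos)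
  then have kn: "k < n" by simp
  \<comment> \<open>\<open>small\<close> does not cover the point \<open>a\<close>; there the claim
    is 0 \<le> D, which follows from \<open>small\<close> at \<open>c\<close>.\<close>
  have small': "norm (S u - S a) \<le> D" if "a \<le> u" "u \<le> c" for u
  proof (cases "u = a")
    case True
    have "norm (S c - S a) \<le> D" using small ac by simp
    then have "0 \<le> D" using norm_ge_zero[of "S c - S a"] by linarith
    with True show ?thesis by simp
  qed (use small that in auto)
  obtain u where u: "u \<in> {k * T / n..Suc k * T / n}" "real n powr - \<alpha> < norm (S u - S (k * T / n))"
    using osc[OF n(1) kn] by blast
  have "norm (S u - S (k * T / n)) \<le> norm (S u - S a) + norm (S (k * T / n) - S a)"
    using norm_triangle_ineq4[of "S u - S a" "S (k * T / n) - S a"] by simp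
  also have "\<dots> \<le> D + D"
    using u(1) ak kc by (intro add_mono small') auto
  finally have lt: "real n powr - \<alpha> < 2 * D" using u(2) by simp
  have "L \<le> 3 * T * real n0 * (1 / real n)"
    using nle L n by (simp add: field_simps)
  also have "1 / real n = (real n powr - \<alpha>) powr (1 / \<alpha>)"
  proof -
    have "(real n powr - \<alpha>) powr (1 / \<alpha>) = real n powr (- \<alpha> * (1 / \<alpha>))" by (rule powr_powr)
    also have "- \<alpha> * (1 / \<alpha>) = - 1" using \<alpha> by simp
    also have "real n powr - 1 = 1 / real n" using n by (simp add: powr_minus_divide)
    finally show ?thesis by simp
  qed
  also have "\<dots> \<le> (2 * D) powr (1 / \<alpha>)"
    using lt \<alpha> by (intro powr_mono2) auto
  finally show ?thesis using T by (simp add: L_def mult_left_mono)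
qed

section \<open>Nondegeneracy of the integrand along a path\<close>

text \<open>Each entry of \<open>A\<close> is a coordinate of the image of a unit vector, so the
  operator norm bounds it. This converts the induced norm of \<open>cond_A_sigma\<close> into the
  Frobenius norm used elsewhere.\<close>

lemma onorm_matrix_ge_norm:
  fixes A :: "real ^ 'n ^ 'm"
  shows "norm A \<le> CARD('m) * CARD('n) * onorm ((*v) A)"
proof -
  have e: "\<bar>A $ i $ j\<bar> \<le> onorm ((*v) A)" for i j
  proof -
    have "\<bar>A $ i $ j\<bar> = \<bar>(A *v axis j 1) $ i\<bar>"
      by (simp add: matrix_vector_mult_basis column_def)
    also have "\<dots> \<le> norm (A *v axis j 1)" by (rule component_le_norm_cart)
    also have "\<dots> \<le> onorm ((*v) A) * norm (axis j (1::real) :: real ^ 'n)"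
      by (rule onorm[OF matrix_vector_mul_bounded_linear])
    finally show ?thesis by simp
  qed
  have "norm A \<le> (\<Sum>i\<in>UNIV. norm (A $ i))"
    unfolding norm_vec_def by (rule L2_set_le_sum) simp
  also have "\<dots> \<le> (\<Sum>i\<in>(UNIV::'m set). \<Sum>j\<in>(UNIV::'n set). onorm ((*v) A))"
  proof (rule sum_mono)
    fix i
    have "norm (A $ i) \<le> (\<Sum>j\<in>UNIV. \<bar>A $ i $ j\<bar>)" by (rule norm_le_l1_cart)
    also have "\<dots> \<le> (\<Sum>j\<in>(UNIV::'n set). onorm ((*v) A))" by (intro sum_mono e)
    finally show "norm (A $ i) \<le> (\<Sum>j\<in>(UNIV::'n set). onorm ((*v) A))" .
  qed
  finally show ?thesis by simp
qed

lemma continuous_on_from_onorm_bound: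
  fixes \<sigma> :: "real \<Rightarrow> real ^ 'n ^ 'm" and S :: "real \<Rightarrow> 'b::real_normed_vector"
  assumes S: "continuous_on A S" and \<theta>: "0 < \<theta>"
    and bound: "\<And>s t. s \<in> A \<Longrightarrow> t \<in> A \<Longrightarrow>
      onorm ((*v) (\<sigma> t - \<sigma> s)) \<le> C * (norm (S t - S s) powr \<theta> + \<bar>t - s\<bar> powr (\<theta> / 2))"
  shows "continuous_on A \<sigma>"
  unfolding continuous_on_def
proof
  fix s assume s: "s \<in> A"
  let ?K = "real (CARD('m) * CARD('n))"
  let ?g = "\<lambda>t. ?K * (C * (norm (S t - S s) powr \<theta> + \<bar>t - s\<bar> powr (\<theta> / 2)))"
  have St: "(S \<longlongrightarrow> S s) (at s within A)" using S s by (simp add: continuous_on_def)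
  have "((\<lambda>t. norm (S t - S s)) \<longlongrightarrow> norm (S s - S s)) (at s within A)"
    by (intro tendsto_intros St)
  then have 1: "((\<lambda>t. norm (S t - S s) powr \<theta>) \<longlongrightarrow> 0) (at s within A)"
    using \<theta> by (intro tendsto_eq_rhs[OF tendsto_powr'[OF _ tendsto_const]]) auto
  have "((\<lambda>t. \<bar>t - s\<bar>) \<longlongrightarrow> \<bar>s - s\<bar>) (at s within A)"
    by (intro tendsto_intros)
  then have 2: "((\<lambda>t. \<bar>t - s\<bar> powr (\<theta> / 2)) \<longlongrightarrow> 0) (at s within A)"
    using \<theta> by (intro tendsto_eq_rhs[OF tendsto_powr'[OF _ tendsto_const]]) auto
  have "(?g \<longlongrightarrow> ?K * (C * (0 + 0))) (at s within A)"
    by (intro tendsto_mult tendsto_const tendsto_add 1 2)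
  then have g: "(?g \<longlongrightarrow> 0) (at s within A)" by simp
  have "((\<lambda>t. \<sigma> t - \<sigma> s) \<longlongrightarrow> 0) (at s within A)"
  proof (rule Lim_null_comparison[OF _ g])
    show "\<forall>\<^sub>F t in at s within A. norm (\<sigma> t - \<sigma> s) \<le> ?g t"
      unfolding eventually_at_filter
    proof (intro always_eventually allI impI)
      fix t assume "t \<in> A"
      then have "?K * onorm ((*v) (\<sigma> t - \<sigma> s)) \<le> ?g t"
        using bound[OF s] by (intro mult_left_mono) auto
      with onorm_matrix_ge_norm[of "\<sigma> t - \<sigma> s"] show "norm (\<sigma> t - \<sigma> s) \<le> ?g t"
        unfolding of_nat_mult by (rule order_trans)
    qed
  qed
  then show "(\<sigma> \<longlongrightarrow> \<sigma> s) (at s within A)" by (simp add: LIM_zero_iff)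
qed

text \<open>Pigeonhole: the squared Frobenius norm is the sum of the squared row norms, so some row
  carries at least the share 1 / \<open>CARD('m)\<close> of the total integral.\<close>

lemma quadratic_variation_coordinate:
  fixes \<sigma> :: "real \<Rightarrow> real ^ 'n::finite ^ 'm::finite"
  assumes \<sigma>: "continuous_on {s..t} \<sigma>" and st: "s \<le> t" and \<kappa>: "0 \<le> \<kappa>"
    and lower: "\<And>r. r \<in> {s..t} \<Longrightarrow> \<kappa> \<le> norm (\<sigma> r)"
  shows "\<exists>i. ennreal (\<kappa>\<^sup>2 / CARD('m) * (t - s)) \<le> (\<integral>\<^sup>+r\<in>{s<..t}. ennreal ((norm (\<sigma> r $ i))\<^sup>2) \<partial>lborel)"
proof (rule ccontr)
  let ?Q = "\<lambda>i. \<integral>\<^sup>+r\<in>{s<..t}. ennreal ((norm (\<sigma> r $ i))\<^sup>2) \<partial>lborel"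
  let ?q = "\<kappa>\<^sup>2 / CARD('m) * (t - s)"
  assume "\<not> ?thesis"
  then have lt: "?Q i < ennreal ?q" for i by (simp add: not_le)
  have m: "(\<lambda>r. ennreal ((norm (\<sigma> r $ i))\<^sup>2) * indicator {s<..t} r) \<in> borel_measurable borel" for i
  proof -
    have "continuous_on {s<..t} (\<lambda>r. (norm (\<sigma> r $ i))\<^sup>2)"
      by (intro continuous_intros continuous_on_subset[OF \<sigma>]) auto
    then have "(\<lambda>r. (norm (\<sigma> r $ i))\<^sup>2) \<in> borel_measurable (restrict_space borel {s<..t})"
      by (rule borel_measurable_continuous_on_restrict)
    then have "(\<lambda>r. ennreal ((norm (\<sigma> r $ i))\<^sup>2)) \<in> borel_measurable (restrict_space borel {s<..t})"
      by measurable
    then show ?thesis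
      by (subst (asm) borel_measurable_restrict_space_iff_ennreal) auto
  qed
  \<comment> \<open>Integrals below a finite threshold are finite, so the contradiction can be drawn
    in the reals.\<close>
  obtain x where x: "\<And>i. ?Q i = ennreal (x i)" "\<And>i. 0 \<le> x i" "\<And>i. x i < ?q"
  proof
    fix i
    have "?Q i < top" using lt[of i] by (rule less_trans) simp
    then show Qi: "?Q i = ennreal (enn2real (?Q i))" by simp
    show "0 \<le> enn2real (?Q i)" by simp
    then show "enn2real (?Q i) < ?q"
      using lt[of i] by (subst (asm) Qi) (simp only: ennreal_less_iff)
  qed
  have "ennreal (\<kappa>\<^sup>2 * (t - s)) = (\<integral>\<^sup>+r\<in>{s<..t}. ennreal (\<kappa>\<^sup>2) \<partial>lborel)"
    using st by (simp add: nn_integral_cmult_indicator ennreal_mult)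
  also have "\<dots> \<le> (\<integral>\<^sup>+r. (\<Sum>i\<in>UNIV. ennreal ((norm (\<sigma> r $ i))\<^sup>2) * indicator {s<..t} r) \<partial>lborel)"
  proof (rule nn_integral_mono)
    fix r
    show "ennreal (\<kappa>\<^sup>2) * indicator {s<..t} r \<le> (\<Sum>i\<in>UNIV. ennreal ((norm (\<sigma> r $ i))\<^sup>2) * indicator {s<..t} r)"
    proof (cases "r \<in> {s<..t}")
      case True
      then have "\<kappa>\<^sup>2 \<le> (norm (\<sigma> r))\<^sup>2" using lower[of r] \<kappa> by (intro power_mono) auto
      also have "\<dots> = (\<Sum>i\<in>UNIV. (norm (\<sigma> r $ i))\<^sup>2)"
        by (simp add: norm_vec_def[where 'b="'m"] L2_set_def sum_nonneg)
      finally show ?thesis using True by (simp add: sum_ennreal ennreal_leI)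
    qed simp
  qed
  also have "\<dots> = (\<Sum>i\<in>UNIV. ?Q i)"
    using m by (intro nn_integral_sum) auto
  also have "\<dots> = ennreal (\<Sum>i\<in>UNIV. x i)"
    using x by (simp add: sum_ennreal)
  finally have "\<kappa>\<^sup>2 * (t - s) \<le> (\<Sum>i\<in>UNIV. x i)"
    using x(2) by (simp add: ennreal_le_iff sum_nonneg)
  also have "\<dots> < (\<Sum>i\<in>(UNIV::'m set). ?q)"
    using x(3) by (intro sum_strict_mono) auto
  also have "\<dots> = \<kappa>\<^sup>2 * (t - s)" by simp
  finally show False by simp
qed

text \<open>Along a path \<sigma> is continuous and nonzero on a compact interval, so |\<sigma>| has
  a positive minimum \<kappa>. It is random, whereas \<open>ito_oscillation_lower_bound\<close>
  takes a deterministic threshold; that lemma is invoked for all T / (K + 1) at once, and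
  \<open>K\<close> is chosen on each path.\<close>

lemma oscillation_modulus:
  fixes S :: "real \<Rightarrow> 'w \<Rightarrow> real ^ 'd::finite" and T :: real
  assumes model: "model M T B \<sigma> S" and A: "cond_A_sigma M T \<sigma> S \<theta>" and \<eta>: "0 < \<eta>"
  shows "AE \<omega> in M. \<exists>n0\<ge>1. \<forall>n\<ge>n0. \<forall>k<n.
    \<exists>u\<in>{k * T / n..Suc k * T / n}. real n powr - (1 / 2 + \<eta>) < norm (S u \<omega> - S (k * T / n) \<omega>)"
proof -
  interpret brownian M T B
    using model by (intro brownian.intro) (auto simp: model_def)
  have T: "0 < T" and ito: "is_ito_integral M F B T \<sigma> (\<lambda>t \<omega>. S t \<omega> - S 0 \<omega>)"
    using model by (auto simp: model_def)
  have cont: "AE \<omega> in M. continuous_on {0..T} (\<lambda>t. S t \<omega> - S 0 \<omega>)"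
    using ito by (simp add: is_ito_integral_def)
  have nz: "AE \<omega> in M. \<forall>t\<in>{0..T}. \<sigma> t \<omega> \<noteq> 0" and \<theta>: "0 < \<theta>"
    using A by (auto simp: cond_A_sigma_def)
  obtain C where C: "AE \<omega> in M. \<forall>s\<in>{0..T}. \<forall>t\<in>{0..T}. onorm ((*v) (\<sigma> t \<omega> - \<sigma> s \<omega>))
      \<le> C \<omega> * (norm (S t \<omega> - S s \<omega>) powr \<theta> + \<bar>t - s\<bar> powr (\<theta> / 2))"
    using A unfolding cond_A_sigma_def by blast
  have "AE \<omega> in M. \<forall>K::nat. eventually (\<lambda>n. \<forall>k<n. \<forall>i.
    ennreal (T / Suc K / n) \<le> (\<integral>\<^sup>+r\<in>{k * T / n<..Suc k * T / n}. ennreal ((norm (\<sigma> r \<omega> $ i))\<^sup>2) \<partial>lborel) \<longrightarrow>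
    (\<exists>u\<in>{k * T / n..Suc k * T / n}. real n powr - (1 / 2 + \<eta>) <
      \<bar>(S u \<omega> - S 0 \<omega>) $ i - (S (k * T / n) \<omega> - S 0 \<omega>) $ i\<bar>)) sequentially"
    unfolding AE_all_countable
    using T \<eta> by (intro allI ito_oscillation_lower_bound[OF ito]) auto
  with cont nz C show ?thesis
  proof eventually_elim
    case (elim \<omega>)
    have Sc: "continuous_on {0..T} (\<lambda>t. S t \<omega>)"
      using continuous_on_add[OF elim(1) continuous_on_const[of _ "S 0 \<omega>"]] by simp
    have \<sigma>c: "continuous_on {0..T} (\<lambda>t. \<sigma> t \<omega>)"
      using elim(3) by (intro continuous_on_from_onorm_bound[OF Sc \<theta>, where C = "C \<omega>"]) blast
    obtain r where r: "r \<in> {0..T}" "\<And>t. t \<in> {0..T} \<Longrightarrow> norm (\<sigma> r \<omega>) \<le> norm (\<sigma> t \<omega>)"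
      using continuous_attains_inf[OF compact_Icc _ continuous_on_norm[OF \<sigma>c]] T
      by (metis atLeastatMost_empty_iff2 less_imp_le not_le)
    define \<kappa> where "\<kappa> = norm (\<sigma> r \<omega>)"
    have \<kappa>: "0 < \<kappa>" using elim(2) r(1) by (simp add: \<kappa>_def)
    then have "0 < \<kappa>\<^sup>2 / CARD('d)" by simp
    \<comment> \<open>With this \<open>K\<close>, the row found by
      \<open>quadratic_variation_coordinate\<close> on a cell of length T/n has quadratic variation
      at least T / (K + 1) / n there.\<close>
    then obtain K where K: "inverse (real (Suc K)) < \<kappa>\<^sup>2 / CARD('d)"
      using reals_Archimedean by blast
    obtain n1 where n1: "\<And>n k i. n1 \<le> n \<Longrightarrow> k < n \<Longrightarrow>
      ennreal (T / Suc K / n) \<le> (\<integral>\<^sup>+r\<in>{k * T / n<..Suc k * T / n}. ennreal ((norm (\<sigma> r \<omega> $ i))\<^sup>2) \<partial>lborel) \<Longrightarrow>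
      \<exists>u\<in>{k * T / n..Suc k * T / n}. real n powr - (1 / 2 + \<eta>) <
        \<bar>(S u \<omega> - S 0 \<omega>) $ i - (S (k * T / n) \<omega> - S 0 \<omega>) $ i\<bar>"
      using elim(4)[rule_format, of K] unfolding eventually_sequentially by blast
    have "\<exists>u\<in>{k * T / n..Suc k * T / n}. real n powr - (1 / 2 + \<eta>) < norm (S u \<omega> - S (k * T / n) \<omega>)"
      if n: "max 1 n1 \<le> n" and k: "k < n" for n k
    proof -
      let ?s = "k * T / n" and ?t = "Suc k * T / n"
      have n0: "0 < real n" using k by simp
      have st: "0 \<le> ?s" "?s \<le> ?t" "?t \<le> T" "?t - ?s = T / n"
        using T n0 k mult_left_mono[of "real (Suc k)" "real n" T] by (auto simp: field_simps)
      obtain i where i: "ennreal (\<kappa>\<^sup>2 / CARD('d) * (?t - ?s)) \<le>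
          (\<integral>\<^sup>+r\<in>{?s<..?t}. ennreal ((norm (\<sigma> r \<omega> $ i))\<^sup>2) \<partial>lborel)"
        using quadratic_variation_coordinate[of ?s ?t "\<lambda>t. \<sigma> t \<omega>" \<kappa>]
          continuous_on_subset[OF \<sigma>c, of "{?s..?t}"] st \<kappa> r(2) unfolding \<kappa>_def by auto
      have "T / Suc K / n = inverse (real (Suc K)) * (T / n)" by (simp add: field_simps)
      also have "\<dots> \<le> \<kappa>\<^sup>2 / CARD('d) * (T / n)"
        using K T n0 by (intro mult_right_mono) auto
      finally have "ennreal (T / Suc K / n) \<le> ennreal (\<kappa>\<^sup>2 / CARD('d) * (?t - ?s))"
        unfolding st(4) by (rule ennreal_leI)
      then have "ennreal (T / Suc K / n) \<le> (\<integral>\<^sup>+r\<in>{?s<..?t}. ennreal ((norm (\<sigma> r \<omega> $ i))\<^sup>2) \<partial>lborel)"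
        using i by (rule order_trans)
      then obtain u where u: "u \<in> {?s..?t}" "real n powr - (1 / 2 + \<eta>) <
          \<bar>(S u \<omega> - S 0 \<omega>) $ i - (S ?s \<omega> - S 0 \<omega>) $ i\<bar>"
        using n1[of n k i] n k by auto
      have "\<bar>(S u \<omega> - S 0 \<omega>) $ i - (S ?s \<omega> - S 0 \<omega>) $ i\<bar> \<le> norm (S u \<omega> - S ?s \<omega>)"
        using component_le_norm_cart[of "S u \<omega> - S ?s \<omega>" i] by simp
      with u show ?thesis by (intro bexI[of _ u]) auto
    qed
    then show ?case by (intro exI[of _ "max 1 n1"]) simp
  qed
qed

section \<open>Strategies and their mesh\<close>

lemma grid_interval:
  fixes t :: "nat \<Rightarrow> real"
  assumes "t 0 = 0" "\<And>i. i < N \<Longrightarrow> t i < t (Suc i)" "t N = T" "i \<in> {1..N}"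
  shows "0 \<le> t (i - 1)" "t (i - 1) < t i" "t i \<le> T"
proof -
  have mono: "j \<le> N \<Longrightarrow> t k \<le> t j" if "k \<le> j" for k j
    using that
  proof (induction j rule: dec_induct)
    case (step j)
    then show ?case using assms(2)[of j] by simp
  qed simp
  show "0 \<le> t (i - 1)" using mono[of 0 "i - 1"] assms by auto
  show "t (i - 1) < t i" using assms(2)[of "i - 1"] assms(4) by (cases i) auto
  show "t i \<le> T" using mono[of i N] assms by auto
qed

lemma squared_displacement_bound:
  fixes S :: "real \<Rightarrow> real ^ 'd::finite" and t :: "nat \<Rightarrow> nat \<Rightarrow> real"
  assumes \<epsilon>: "\<And>n. 0 < \<epsilon> n"
    and fin: "(SUP n. ennreal (\<epsilon> n powr - 2) *
        (SUP i\<in>{1..N n}. SUP u\<in>{t n (i - 1)<..t n i}. ennreal ((norm (S u - S (t n (i - 1))))\<^sup>2))) < \<infinity>"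
  shows "\<exists>c>0. \<forall>n. \<forall>i\<in>{1..N n}. \<forall>u\<in>{t n (i - 1)<..t n i}. norm (S u - S (t n (i - 1))) \<le> c * \<epsilon> n"
proof -
  let ?f = "\<lambda>n i u. ennreal ((norm (S u - S (t n (i - 1))))\<^sup>2)"
  let ?Z = "SUP n. ennreal (\<epsilon> n powr - 2) * (SUP i\<in>{1..N n}. SUP u\<in>{t n (i - 1)<..t n i}. ?f n i u)"
  define z where "z = enn2real ?Z"
  have z: "0 \<le> z" "?Z = ennreal z"
    using fin unfolding z_def by (simp_all only: enn2real_nonneg ennreal_enn2real infinity_ennreal_def)
  show ?thesis
  \<comment> \<open>\<open>z\<close> is the value of the supremum; adding 1 to its root keeps the
    constant positive when \<open>z\<close> is 0.\<close>
  proof (intro exI[of _ "sqrt z + 1"] conjI allI ballI)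
    show "0 < sqrt z + 1" using z by (simp add: add_nonneg_pos)
    fix n i u assume i: "i \<in> {1..N n}" and u: "u \<in> {t n (i - 1)<..t n i}"
    let ?d = "norm (S u - S (t n (i - 1)))"
    have "?f n i u \<le> (SUP u\<in>{t n (i - 1)<..t n i}. ?f n i u)"
      using u by (rule SUP_upper)
    also have "\<dots> \<le> (SUP i\<in>{1..N n}. SUP u\<in>{t n (i - 1)<..t n i}. ?f n i u)"
      using i by (rule SUP_upper)
    finally have "ennreal (\<epsilon> n powr - 2) * ?f n i u
        \<le> ennreal (\<epsilon> n powr - 2) * (SUP i\<in>{1..N n}. SUP u\<in>{t n (i - 1)<..t n i}. ?f n i u)"
      by (rule mult_left_mono) simp
    also have "\<dots> \<le> ?Z" by (rule SUP_upper) simp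
    finally have "ennreal (\<epsilon> n powr - 2 * ?d\<^sup>2) \<le> ennreal z"
      using z by (simp add: ennreal_mult)
    then have "\<epsilon> n powr - 2 * ?d\<^sup>2 \<le> z" using z by (simp add: ennreal_le_iff)
    moreover have "\<epsilon> n powr - 2 = 1 / (\<epsilon> n)\<^sup>2"
      using \<epsilon>[of n] by (simp add: powr_minus_divide)
    ultimately have "?d\<^sup>2 \<le> z * (\<epsilon> n)\<^sup>2"
      using \<epsilon>[of n] by (simp add: field_simps)
    then have "sqrt (?d\<^sup>2) \<le> sqrt (z * (\<epsilon> n)\<^sup>2)" by (rule real_sqrt_le_mono)
    then have "?d \<le> sqrt z * \<epsilon> n"
      using \<epsilon>[of n] by (simp add: real_sqrt_mult)
    also have "\<dots> \<le> (sqrt z + 1) * \<epsilon> n" using \<epsilon>[of n] by (intro mult_right_mono) auto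
    finally show "?d \<le> (sqrt z + 1) * \<epsilon> n" .
  qed
qed

text \<open>The exponent 1/\<alpha> tends to 2 as \<alpha> decreases to 1/2, so
  \<open>interval_length_from_oscillation\<close> with D proportional to \<open>\<epsilon> n\<close>
  reaches every \<rho> > 0.\<close>

lemma mesh_bound:
  fixes S :: "real \<Rightarrow> 'w \<Rightarrow> real ^ 'd::finite" and T :: real
  assumes model: "model M T B \<sigma> S" and A: "cond_A_sigma M T \<sigma> S \<theta>"
    and \<epsilon>: "step_sizes \<epsilon>" and strat: "strategies M F' T \<tau> N" and \<rho>: "0 < \<rho>"
    and AS: "cond_A_S M \<epsilon> S \<tau> N"
  shows "AE \<omega> in M. (SUP n. ennreal (\<epsilon> n powr (\<rho> - 2)) * max_step \<tau> N n \<omega>) < \<infinity>"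
proof -
  \<comment> \<open>This is \<eta> = \<rho>/4. Then (2 - \<rho>) \<alpha> = 1 - \<rho>^2/4 \<le> 1,
    so the power of \<open>\<epsilon> n\<close> that is left over has a nonnegative
    exponent.\<close>
  define \<alpha> where "\<alpha> = 1 / 2 + \<rho> / 4"
  have \<alpha>: "0 < \<alpha>" using \<rho> by (simp add: \<alpha>_def)
  have T: "0 < T" using model by (simp add: model_def)
  have \<epsilon>0: "0 < \<epsilon> n" for n using \<epsilon> by (simp add: step_sizes_def)
  \<comment> \<open>A nonnegative power of a bounded positive sequence is bounded; \<open>e\<close>
    provides the bound.\<close>
  have "convergent \<epsilon>" using \<epsilon> by (auto simp: step_sizes_def convergent_def)
  then obtain e where e: "\<And>n. \<epsilon> n \<le> e"
    using Bseq_def convergent_imp_Bseq by (metis abs_le_D1 real_norm_def)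
  have expo: "0 \<le> \<rho> - 2 + 1 / \<alpha>"
  proof -
    have "(2 - \<rho>) * \<alpha> = 1 - \<rho>\<^sup>2 / 4"
      by (simp add: \<alpha>_def power2_eq_square field_simps)
    then have "(2 - \<rho>) * \<alpha> \<le> 1" by simp
    then show ?thesis using \<alpha> by (simp add: field_simps)
  qed
  have "AE \<omega> in M. \<exists>n0\<ge>1. \<forall>n\<ge>n0. \<forall>k<n.
    \<exists>u\<in>{k * T / n..Suc k * T / n}. real n powr - \<alpha> < norm (S u \<omega> - S (k * T / n) \<omega>)"
    unfolding \<alpha>_def using \<rho> by (intro oscillation_modulus[OF model A]) simp
  moreover have "AE \<omega> in M. \<forall>n. \<tau> n 0 \<omega> = 0 \<and> (\<forall>i < N n \<omega>. \<tau> n i \<omega> < \<tau> n (Suc i) \<omega>) \<and>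
        (\<forall>i \<ge> N n \<omega>. \<tau> n i \<omega> = T)"
    using strat unfolding strategies_def AE_all_countable by blast
  moreover have "AE \<omega> in M. (SUP n. ennreal (\<epsilon> n powr - 2) *
        (SUP i\<in>{1..N n \<omega>}. SUP t\<in>{\<tau> n (i - 1) \<omega><..\<tau> n i \<omega>}.
           ennreal ((norm (S t \<omega> - S (\<tau> n (i - 1) \<omega>) \<omega>))\<^sup>2))) < \<infinity>"
    using AS by (simp add: cond_A_S_def)
  ultimately show ?thesis
  proof eventually_elim
    case (elim \<omega>)
    obtain n0 where n0: "1 \<le> n0" "\<And>n k. n0 \<le> n \<Longrightarrow> k < n \<Longrightarrow>
      \<exists>u\<in>{k * T / n..Suc k * T / n}. real n powr - \<alpha> < norm (S u \<omega> - S (k * T / n) \<omega>)"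
      using elim(1) by blast
    obtain c where c: "0 < c" "\<And>n i u. i \<in> {1..N n \<omega>} \<Longrightarrow> u \<in> {\<tau> n (i - 1) \<omega><..\<tau> n i \<omega>} \<Longrightarrow>
        norm (S u \<omega> - S (\<tau> n (i - 1) \<omega>) \<omega>) \<le> c * \<epsilon> n"
      using squared_displacement_bound[OF \<epsilon>0 elim(3)] by blast
    define C where "C = 3 * T * real n0 * (2 * c) powr (1 / \<alpha>)"
    have C: "0 \<le> C" using T by (simp add: C_def)
    have step: "\<tau> n i \<omega> - \<tau> n (i - 1) \<omega> \<le> C * \<epsilon> n powr (1 / \<alpha>)" if i: "i \<in> {1..N n \<omega>}" for n i
    proof -
      have "0 \<le> \<tau> n (i - 1) \<omega>" "\<tau> n (i - 1) \<omega> < \<tau> n i \<omega>" "\<tau> n i \<omega> \<le> T"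
        using grid_interval[of "\<lambda>i. \<tau> n i \<omega>" "N n \<omega>" T i] elim(2) i by auto
      then have "\<tau> n i \<omega> - \<tau> n (i - 1) \<omega> \<le> 3 * T * real n0 * (2 * (c * \<epsilon> n)) powr (1 / \<alpha>)"
        using c(2)[OF i] by (intro interval_length_from_oscillation[OF T \<alpha> n0]) auto
      also have "\<dots> = C * \<epsilon> n powr (1 / \<alpha>)"
        using c(1) \<epsilon>0[of n] by (simp add: C_def powr_mult)
      finally show ?thesis .
    qed
    have "(SUP n. ennreal (\<epsilon> n powr (\<rho> - 2)) * max_step \<tau> N n \<omega>) \<le> ennreal (C * e powr (\<rho> - 2 + 1 / \<alpha>))"
    proof (rule SUP_least)
      fix n
      have "max_step \<tau> N n \<omega> \<le> ennreal (C * \<epsilon> n powr (1 / \<alpha>))"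
        unfolding max_step_def by (intro SUP_least ennreal_leI step)
      then have "ennreal (\<epsilon> n powr (\<rho> - 2)) * max_step \<tau> N n \<omega>
          \<le> ennreal (\<epsilon> n powr (\<rho> - 2)) * ennreal (C * \<epsilon> n powr (1 / \<alpha>))"
        by (rule mult_left_mono) simp
      also have "\<dots> = ennreal (C * \<epsilon> n powr (\<rho> - 2 + 1 / \<alpha>))"
        using C by (simp add: powr_add ac_simps flip: ennreal_mult)
      also have "\<dots> \<le> ennreal (C * e powr (\<rho> - 2 + 1 / \<alpha>))"
        using e[of n] \<epsilon>0[of n] C expo by (intro ennreal_leI mult_left_mono powr_mono2) auto
      finally show "ennreal (\<epsilon> n powr (\<rho> - 2)) * max_step \<tau> N n \<omega> \<le> ennreal (C * e powr (\<rho> - 2 + 1 / \<alpha>))" .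
    qed
    then show ?case by (rule le_less_trans) simp
  qed
qed

theorem corollary2p2:
  fixes M :: "'w measure" and T :: real
    and B S :: "real \<Rightarrow> 'w \<Rightarrow> real ^ 'd::finite"
    and \<sigma> :: "real \<Rightarrow> 'w \<Rightarrow> real ^ 'd ^ 'd"
    and \<epsilon> :: "nat \<Rightarrow> real" and \<tau> :: "nat \<Rightarrow> nat \<Rightarrow> 'w \<Rightarrow> real" and N :: "nat \<Rightarrow> 'w \<Rightarrow> nat"
    and \<theta> \<rho>\<^sub>N \<rho> :: real
  assumes "model M T B \<sigma> S"
    and "cond_A_sigma M T \<sigma> S \<theta>"
    and "step_sizes \<epsilon>"
    and "strategies M (augmented_filtration M T B) T \<tau> N"
    and "\<rho> > 0"
  shows "(cond_A_S M \<epsilon> S \<tau> N \<longrightarrow>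
            (AE \<omega> in M. (SUP n. ennreal (\<epsilon> n powr (\<rho> - 1)) * max_step \<tau> N n \<omega>) < \<infinity>)) \<and>
         (cond_A_S M \<epsilon> S \<tau> N \<and> cond_A_N M \<epsilon> N \<theta> \<rho>\<^sub>N \<longrightarrow>
            (AE \<omega> in M. (SUP n. ennreal (\<epsilon> n powr (\<rho> - 2)) * max_step \<tau> N n \<omega>) < \<infinity>))"
proof (intro conjI impI)
  assume "cond_A_S M \<epsilon> S \<tau> N"
  \<comment> \<open>The exponent is \<rho> - 1 = (\<rho> + 1) - 2.\<close>
  with assms show "AE \<omega> in M. (SUP n. ennreal (\<epsilon> n powr (\<rho> - 1)) * max_step \<tau> N n \<omega>) < \<infinity>"
    using mesh_bound[OF assms(1-4), of "\<rho> + 1"] by simp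
next
  assume "cond_A_S M \<epsilon> S \<tau> N \<and> cond_A_N M \<epsilon> N \<theta> \<rho>\<^sub>N"
  then show "AE \<omega> in M. (SUP n. ennreal (\<epsilon> n powr (\<rho> - 2)) * max_step \<tau> N n \<omega>) < \<infinity>"
    using mesh_bound[OF assms] by blast
qed

end
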